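(* Let $N\ge p-1$. For all $n\in\mathbb N_0$ and $k,l\in\{0,\dots,N\}$ the iterated transition probabilities of the finite Markov chains with transition matrices $\tilde P^{[N]}_{II}$ and $\tilde P^{[N]}_{I}$ have the spectral representation $$\Big(\big(\tilde P_{II}^{[N]}\big)^n\Big)_{k,l}=\Theta^{[N]}_{II,k,l}\left\langle A^{(1)}_{l}\mu_1^{[N]}+\cdots+A^{(p)}_{l}\mu_p^{[N]},\,x_N^nB_k\right\rangle,$$ $$\Big(\big(\tilde P_{I}^{[N]}\big)^n\Big)_{k,l}=\Theta^{[N]}_{I,l,k}\left\langle A^{(1)}_{k}\mu_1^{[N]}+\cdots+A^{(p)}_{k}\mu_p^{[N]},\,x_N^nB_l\right\rangle,$$ where $x_N=x/\lambda_1^{[N]}$.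
   Context: Fix an integer $p\ge 1$; $\mathbb N_0=\{0,1,2,\dots\}$. $T=(T_{i,j})_{i,j\ge 0}$ is a real semi-infinite monic banded lower Hessenberg matrix: $T_{n,n+1}=1$, $T_{i,j}=0$ if $j>i+1$ or $j<i-p$, and $T_{n,n-p}\neq0$ for $n\ge p$. $T^{[N]}=(T_{i,j})_{0\le i,j\le N}$. $T$ admits a positive bidiagonal factorization: $T=L_1\cdots L_pU$, where $L_k$ is lower bidiagonal with unit diagonal and $(L_k)_{j+1,j}=\alpha_{k+1+j(p+1)}$, $U$ is upper bidiagonal with unit superdiagonal and $U_{j,j}=\alpha_{1+j(p+1)}$ ($j\in\mathbb N_0$), and all $\alpha_i>0$. Moreover $T$ is associated with a semi-infinite stochastic matrix: there is a diagonal matrix $\pi$ with positive diagonal entries such that $\pi T\pi^{-1}$ or $\pi^{-1}T^\top\pi$ is stochastic. Type II polynomials: $B_0=1$, $B_{n+1}=(x-T_{n,n})B_n-T_{n,n-1}B_{n-1}-\cdots-T_{n,n-p}B_{n-p}$ (terms with negative index are $0$). Type I polynomials: given a real lower unitriangular $p\times p$ matrix $\nu$, $A^{(a)}_{j}=\nu_{j+1,a}$ for $0\le j\le p-1$, $A^{(a)}_{-1}=0$, and $A^{(a)}_{n-1}+T_{n,n}A^{(a)}_n+\cdots+T_{n+p,n}A^{(a)}_{n+p}=xA^{(a)}_n$, $n\in\mathbb N_0$, $a\in\{1,\dots,p\}$. The zeros of $B_{N+1}$ (eigenvalues of $T^{[N]}$) are simple and positive, $\lambda^{[N]}_1>\cdots>\lambda^{[N]}_{N+1}>0$.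 Let $\mathscr U=(B_{i-1}(\lambda^{[N]}_j))_{1\le i,j\le N+1}$, $\mathscr W=\mathscr U^{-1}=(w_{k,n})$, $(\mu^{[N]}_{k,1},\dots,\mu^{[N]}_{k,p})^\top=\nu^{-1}(w_{k,1},\dots,w_{k,p})^\top$, and $\mu_a^{[N]}=\sum_{k=1}^{N+1}\mu^{[N]}_{k,a}\,\delta(x-\lambda^{[N]}_k)$. The bracket $\langle\sum_af_a\mu^{[N]}_a,g\rangle$ means $\sum_a\sum_{k=1}^{N+1}\mu^{[N]}_{k,a}f_a(\lambda_k^{[N]})g(\lambda^{[N]}_k)$. Truncated polynomials: $B^{[k]}_{N+1}(x)=\det(xI_{N+1-k}-T^{[N,k]})$ with $T^{[N,k]}=(T_{i,j})_{k\le i,j\le N}$, and $B^{[N+1]}_{N+1}=1$. The finite stochastic matrices are $\tilde P^{[N]}_{II}=\tilde\pi_{II}\,\frac{T^{[N]}}{\lambda_1^{[N]}}\,\tilde\pi_{II}^{-1}$ and $\tilde P^{[N]}_{I}=\tilde\pi_{I}^{-1}\,\frac{(T^{[N]})^\top}{\lambda_1^{[N]}}\,\tilde\pi_{I}$, where $\tilde\pi_{II}=\mathrm{diag}(\tilde\pi_{II,0},\dots,\tilde\pi_{II,N})$, $\tilde\pi_{II,n}=1/B_n(\lambda_1^{[N]})$, and $\tilde\pi_{I}=\mathrm{diag}(\tilde\pi_{I,0},\dots,\tilde\pi_{I,N})$, $\tilde\pi_{I,n}=B^{[n+1]}_{N+1}(\lambda_1^{[N]})/B^{[1]}_{N+1}(\lambda_1^{[N]})$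 (all these numbers are positive). Finally $\Theta^{[N]}_{II,k,l}=\tilde\pi_{II,k}/\tilde\pi_{II,l}=B_l(\lambda_1^{[N]})/B_k(\lambda_1^{[N]})$ and $\Theta^{[N]}_{I,l,k}=\tilde\pi_{I,l}/\tilde\pi_{I,k}=B^{[l+1]}_{N+1}(\lambda_1^{[N]})/B^{[k+1]}_{N+1}(\lambda_1^{[N]})$. Matrix indices of $\tilde P$ run over $\{0,\dots,N\}$. *)

theory Defs
  imports
    Complex_Main
    "Jordan_Normal_Form.Char_Poly"
    "Jordan_Normal_Form.Gauss_Jordan_Elimination"
begin

type_synonym imat = "nat \<Rightarrow> nat \<Rightarrow> real"

definition banded_hessenberg :: "nat \<Rightarrow> imat \<Rightarrow> bool" where
  "banded_hessenberg p T \<longleftrightarrow>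
     (\<forall>n. T n (n + 1) = 1) \<and>
     (\<forall>i j. j > i + 1 \<longrightarrow> T i j = 0) \<and>
     (\<forall>i j. j + p < i \<longrightarrow> T i j = 0) \<and>
     (\<forall>n\<ge>p. T n (n - p) \<noteq> 0)"

text \<open>The product is meaningful when every row of \<open>A\<close> has finite support, as is the case for
  the bidiagonal factors below.\<close>

definition imat_mult :: "imat \<Rightarrow> imat \<Rightarrow> imat" where
  "imat_mult A B = (\<lambda>i j. \<Sum>m | A i m \<noteq> 0. A i m * B m j)"

definition L_factor :: "nat \<Rightarrow> (nat \<Rightarrow> real) \<Rightarrow> nat \<Rightarrow> imat" where
  "L_factor p \<alpha> k = (\<lambda>i j. if i = j then 1
                       else if i = j + 1 then \<alpha> (k + 1 + j * (p + 1)) else 0)"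

definition U_factor :: "nat \<Rightarrow> (nat \<Rightarrow> real) \<Rightarrow> imat" where
  "U_factor p \<alpha> = (\<lambda>i j. if i = j then \<alpha> (1 + j * (p + 1))
                     else if j = i + 1 then 1 else 0)"

definition positive_bidiagonal_factorization :: "nat \<Rightarrow> imat \<Rightarrow> bool" where
  "positive_bidiagonal_factorization p T \<longleftrightarrow>
     (\<exists>\<alpha>. (\<forall>i\<ge>1. \<alpha> i > 0) \<and>
          T = foldr imat_mult (map (L_factor p \<alpha>) [1..<p + 1]) (U_factor p \<alpha>))"

definition istochastic :: "imat \<Rightarrow> bool" where
  "istochastic P \<longleftrightarrow> (\<forall>i j. 0 \<le> P i j) \<and> (\<forall>i. (\<lambda>j. P i j) sums 1)"

text \<open>The two alternatives are the entries of \<open>\<pi> T \<pi>\<^sup>-\<^sup>1\<close> and of \<open>\<pi>\<^sup>-\<^sup>1 T\<^sup>\<top> \<pi>\<close>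
  for the diagonal matrix with diagonal \<open>\<pi>\<close>.\<close>

definition stochastic_associated :: "imat \<Rightarrow> bool" where
  "stochastic_associated T \<longleftrightarrow>
     (\<exists>\<pi>. (\<forall>n. \<pi> n > 0) \<and>
          (istochastic (\<lambda>i j. \<pi> i * T i j * inverse (\<pi> j)) \<or>
           istochastic (\<lambda>i j. inverse (\<pi> i) * T j i * \<pi> j)))"

text \<open>The lower summation bound uses truncated subtraction, so that terms with a negative
  index are dropped.\<close>

function B_poly :: "nat \<Rightarrow> imat \<Rightarrow> nat \<Rightarrow> real poly" where
  "B_poly p T 0 = 1"
| "B_poly p T (Suc n) =
     [:- T n n, 1:] * B_poly p T n - (\<Sum>j\<in>{n - p..<n}. Polynomial.smult (T n j) (B_poly p T j))"
  by pat_completeness auto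
termination by (relation "measure (\<lambda>(p, T, n). n)") auto

definition lower_unitriangular :: "nat \<Rightarrow> real mat \<Rightarrow> bool" where
  "lower_unitriangular p \<nu> \<longleftrightarrow> \<nu> \<in> carrier_mat p p \<and>
     (\<forall>i<p. \<nu> $$ (i, i) = 1) \<and> (\<forall>i<p. \<forall>j<p. i < j \<longrightarrow> \<nu> $$ (i, j) = 0)"

text \<open>\<open>A a n\<close> is the polynomial \<open>A\<^sup>(\<^sup>a\<^sup>)\<^sub>n\<close> with \<open>a\<close> in \<open>{1..p}\<close>. Entries of type
  \<^typ>\<open>real mat\<close> are indexed from 0, hence the shifts by one from here on.
  Since \<open>T (n + p) n \<noteq> 0\<close>, these conditions determine \<open>A a n\<close> uniquely.\<close>

definition typeI_polys ::
    "nat \<Rightarrow> imat \<Rightarrow> real mat \<Rightarrow> (nat \<Rightarrow> nat \<Rightarrow> real poly) \<Rightarrow> bool" where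
  "typeI_polys p T \<nu> A \<longleftrightarrow> (\<forall>a\<in>{1..p}.
     (\<forall>j<p. A a j = [:\<nu> $$ (j, a - 1):]) \<and>
     (\<forall>n. (if n = 0 then 0 else A a (n - 1)) + (\<Sum>i\<in>{0..p}. Polynomial.smult (T (n + i) n) (A a (n + i)))
          = [:0, 1:] * A a n))"

definition trunc_mat :: "imat \<Rightarrow> nat \<Rightarrow> real mat" where
  "trunc_mat T N = mat (N + 1) (N + 1) (\<lambda>(i, j). T i j)"

definition trunc_mat_from :: "imat \<Rightarrow> nat \<Rightarrow> nat \<Rightarrow> real mat" where
  "trunc_mat_from T N k = mat (N + 1 - k) (N + 1 - k) (\<lambda>(i, j). T (k + i) (k + j))"

definition B_trunc :: "imat \<Rightarrow> nat \<Rightarrow> nat \<Rightarrow> real poly" where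
  "B_trunc T N k = char_poly (trunc_mat_from T N k)"

lemma B_trunc_last: "B_trunc T N (N + 1) = 1"
  by (simp add: B_trunc_def trunc_mat_from_def char_poly_def char_poly_matrix_def)

text \<open>The real zeros of \<open>B\<^sub>N\<^sub>+\<^sub>1\<close> in decreasing order, \<open>zero_B p T N 1\<close> being the largest.
  That there are \<open>N + 1\<close> of them is a consequence of the positive bidiagonal factorization.\<close>

definition zero_B :: "nat \<Rightarrow> imat \<Rightarrow> nat \<Rightarrow> nat \<Rightarrow> real" where
  "zero_B p T N k = rev (sorted_list_of_set {x. poly (B_poly p T (N + 1)) x = 0}) ! (k - 1)"

text \<open>Only applied to invertible matrices.\<close>

definition mat_inv :: "real mat \<Rightarrow> real mat" where
  "mat_inv M = the (mat_inverse M)"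

definition eigvec_mat :: "nat \<Rightarrow> imat \<Rightarrow> nat \<Rightarrow> real mat" where
  "eigvec_mat p T N =
     mat (N + 1) (N + 1) (\<lambda>(i, j). poly (B_poly p T i) (zero_B p T N (j + 1)))"

definition mass :: "nat \<Rightarrow> imat \<Rightarrow> real mat \<Rightarrow> nat \<Rightarrow> nat \<Rightarrow> nat \<Rightarrow> real" where
  "mass p T \<nu> N k a =
     (mat_inv \<nu> *\<^sub>v vec p (\<lambda>i. mat_inv (eigvec_mat p T N) $$ (k - 1, i))) $ (a - 1)"

text \<open>The bracket \<open>\<langle>\<Sum>\<^sub>a f\<^sub>a \<mu>\<^sub>a, g\<rangle>\<close>, where \<open>\<mu>\<^sub>a\<close> has the (signed) mass \<open>mass p T \<nu> N k a\<close> at the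
  \<open>k\<close>-th zero of \<open>B\<^sub>N\<^sub>+\<^sub>1\<close>.\<close>

definition bracket ::
    "nat \<Rightarrow> imat \<Rightarrow> real mat \<Rightarrow> nat \<Rightarrow> (nat \<Rightarrow> real poly) \<Rightarrow> real poly \<Rightarrow> real" where
  "bracket p T \<nu> N f g =
     (\<Sum>a\<in>{1..p}. \<Sum>k\<in>{1..N + 1}.
        mass p T \<nu> N k a * poly (f a) (zero_B p T N k) * poly g (zero_B p T N k))"

definition pi_II :: "nat \<Rightarrow> imat \<Rightarrow> nat \<Rightarrow> nat \<Rightarrow> real" where
  "pi_II p T N n = 1 / poly (B_poly p T n) (zero_B p T N 1)"

definition pi_I :: "nat \<Rightarrow> imat \<Rightarrow> nat \<Rightarrow> nat \<Rightarrow> real" where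
  "pi_I p T N n =
     poly (B_trunc T N (n + 1)) (zero_B p T N 1) / poly (B_trunc T N 1) (zero_B p T N 1)"

definition P_II :: "nat \<Rightarrow> imat \<Rightarrow> nat \<Rightarrow> real mat" where
  "P_II p T N =
     mat_diag (N + 1) (pi_II p T N) * ((1 / zero_B p T N 1) \<cdot>\<^sub>m trunc_mat T N) *
     mat_inv (mat_diag (N + 1) (pi_II p T N))"

definition P_I :: "nat \<Rightarrow> imat \<Rightarrow> nat \<Rightarrow> real mat" where
  "P_I p T N =
     mat_inv (mat_diag (N + 1) (pi_I p T N)) *
     ((1 / zero_B p T N 1) \<cdot>\<^sub>m transpose_mat (trunc_mat T N)) *
     mat_diag (N + 1) (pi_I p T N)"

definition Theta_II :: "nat \<Rightarrow> imat \<Rightarrow> nat \<Rightarrow> nat \<Rightarrow> nat \<Rightarrow> real" where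
  "Theta_II p T N k l = pi_II p T N k / pi_II p T N l"

definition Theta_I :: "nat \<Rightarrow> imat \<Rightarrow> nat \<Rightarrow> nat \<Rightarrow> nat \<Rightarrow> real" where
  "Theta_I p T N l k = pi_I p T N l / pi_I p T N k"

text \<open>The polynomial \<open>x\<^sub>N = x / \<lambda>\<^sub>1\<close>.\<close>

definition x_N :: "nat \<Rightarrow> imat \<Rightarrow> nat \<Rightarrow> real poly" where
  "x_N p T N = Polynomial.smult (1 / zero_B p T N 1) [:0, 1:]"

end

theory Submission
  imports Defs
begin

text \<open>Let \<open>E\<close> be the matrix of the values \<open>B\<^sub>i(\<lambda>\<^sub>j)\<close>. By the recurrence, its columns are right eigenvectors of the
truncated matrix \<open>T\<^sup>[\<^sup>N\<^sup>]\<close> for the zeros \<open>\<lambda>\<^sub>j\<close> of \<open>B\<^sub>N\<^sub>+\<^sub>1\<close>. If there are \<open>N + 1\<close> distinct zeros, \<open>E\<close> is invertible, the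
rows of \<open>W = E\<^sup>-\<^sup>1\<close> are left eigenvectors, and the entries of the powers of \<open>T\<^sup>[\<^sup>N\<^sup>]\<close> are
\<open>\<Sum>\<^sub>j B\<^sub>k(\<lambda>\<^sub>j) \<lambda>\<^sub>j\<^sup>n w\<^sub>j\<^sub>l\<close> (\<open>spectral_pow_entry\<close>). The type I polynomials satisfy the same left recurrence as the
rows of \<open>W\<close>, and the masses are made to match the initial values, so \<open>w\<^sub>j\<^sub>l\<close> is the combination of type I
polynomials in the bracket (\<open>mass_typeI\<close>). Conjugation with diagonal matrices then gives both formulas.

The substance lies in the facts that make these formulas meaningful: \<open>B\<^sub>N\<^sub>+\<^sub>1\<close> has \<open>N + 1\<close> distinct real zeros,
and the weights \<open>B\<^sub>n(\<lambda>\<^sub>1)\<close> and those given by the truncated polynomials at \<open>\<lambda>\<^sub>1\<close> do not vanish. They follow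
from the positive bidiagonal factorization, here without the theory of totally positive matrices. Applying
the factors one at a time to the vector of type II polynomials produces, up to a common factor \<open>x\<close>,
intermediate polynomials. These refine the sequence \<open>B\<^sub>n\<close> to one with the recurrence
\<open>g\<^sub>m = x\<^sup>\<epsilon> g\<^sub>m\<^sub>-\<^sub>1 - \<alpha>\<^sub>m\<^sub>-\<^sub>p g\<^sub>m\<^sub>-\<^sub>p\<^sub>-\<^sub>1\<close>, where \<open>\<epsilon> = 1\<close> if \<open>p + 1\<close> divides \<open>m\<close> and \<open>\<epsilon> = 0\<close> otherwise
(\<open>partial_prod_refined_poly\<close>). Along this recurrence the signs of the Wronskians on the positive half-line persist
(\<open>wronskian_positive\<close>), so consecutive \<open>B\<^sub>n\<close> have a positive Wronskian and their zeros interlace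
(\<open>interlacing_root\<close>). This yields the zeros and the positivity of \<open>B\<^sub>n(\<lambda>\<^sub>1)\<close> (\<open>B_poly_zeros\<close>). The values
\<open>B\<^sub>n(\<lambda>\<^sub>1)\<close> therefore form a positive right eigenvector of the nonnegative matrix \<open>T\<^sup>[\<^sup>N\<^sup>]\<close>, and a
Perron-Frobenius argument shows that \<open>\<lambda>\<^sub>1\<close> is not an eigenvalue of a proper trailing block
(\<open>B_trunc_nonzero\<close>).\<close>

section \<open>Wronskians and interlacing zeros\<close>

text \<open>The numbers \<open>u m\<close> and \<open>v m\<close> stand for the values at \<open>x\<close> of the \<open>m\<close>-th refined polynomial and of its
derivative. The recurrence turns a Wronskian \<open>w i j\<close> into a sum of earlier Wronskians with
nonnegative coefficients, except that each factor \<open>x\<close> contributes a product \<open>u i * u j\<close> of unknown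
sign. What makes the induction close is to control also the Wronskians after one member of the pair
has been multiplied by \<open>x\<close>. Such a factor belongs to the later member if both indices lie in the same
block of length \<open>p + 1\<close>, and to the earlier member otherwise: the multiplied Wronskian is
\<open>x * w i j + u i * u j\<close> in the first case and \<open>x * w i j - u i * u j\<close> in the second.\<close>

lemma wronskian_positive:
  fixes u v :: "nat \<Rightarrow> real"
  assumes x: "x > 0" and a: "\<And>m. m > p \<Longrightarrow> a m > 0"
    and u0: "\<And>m. m \<le> p \<Longrightarrow> u m = 1" and v0: "\<And>m. m \<le> p \<Longrightarrow> v m = 0"
    and u1: "\<And>m. m > p \<Longrightarrow> u m = (if Suc p dvd m then x else 1) * u (m - 1) - a m * u (m - Suc p)"
    and v1: "\<And>m. m > p \<Longrightarrow> v m = (if Suc p dvd m then u (m - 1) + x * v (m - 1) else v (m - 1))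
                 - a m * v (m - Suc p)"
  defines "w \<equiv> \<lambda>i j. u i * v j - v i * u j"
  shows "i < j \<Longrightarrow> j \<le> i + p \<Longrightarrow>
     w i j \<ge> 0 \<and>
     (i div Suc p = j div Suc p \<longrightarrow> x * w i j + u i * u j > 0) \<and>
     (i div Suc p \<noteq> j div Suc p \<longrightarrow> x * w i j - u i * u j > 0)"
proof (induction j arbitrary: i rule: less_induct)
  case (less j)
  show ?case
  proof (cases "j \<le> p")
    case True
    with less.prems show ?thesis by (simp add: w_def u0 v0)
  next
    case False
    then have jp: "j > p" by simp
    define m z where "m = j - 1" and "z = j - Suc p"
    have j: "j = Suc m" "j = z + Suc p" and zm: "z + p = m" using jp by (auto simp: m_def z_def)
    have zi: "z < i" and im: "i \<le> m" using less.prems j by auto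
    have apos: "a j > 0" using a jp .
    have self: "w i' i' = 0" for i' by (simp add: w_def)
    have zdiv: "j div Suc p = Suc (z div Suc p)" using j(2) by (metis div_add_self2 nat.distinct(1) Suc_eq_plus1)
    have IHm: "w i m \<ge> 0 \<and>
     (i div Suc p = m div Suc p \<longrightarrow> x * w i m + u i * u m > 0) \<and>
     (i div Suc p \<noteq> m div Suc p \<longrightarrow> x * w i m - u i * u m > 0)" if "i < m"
      using less.IH[of m i] that j less.prems by auto
    have IHz: "w z i \<ge> 0 \<and>
     (z div Suc p = i div Suc p \<longrightarrow> x * w z i + u z * u i > 0) \<and>
     (z div Suc p \<noteq> i div Suc p \<longrightarrow> x * w z i - u z * u i > 0)"
      using less.IH[of i z] j zi im zm by auto
    show ?thesis
    proof (cases "Suc p dvd j")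
      case True
      have uj: "u j = x * u m - a j * u z" and vj: "v j = u m + x * v m - a j * v z"
        using u1[OF jp] v1[OF jp] True by (auto simp: m_def z_def)
      have same: "i' div Suc p = z div Suc p" if "z \<le> i'" "i' \<le> m" for i'
      proof -
        have "j div Suc p * Suc p = j" using True by (rule dvd_div_mult_self)
        then show ?thesis using zdiv that j
          by (metis Suc_leI div_le_mono div_less_iff_less_mult le_antisym le_imp_less_Suc less_Suc_eq_le zero_less_Suc)
      qed
      \<comment> \<open>The indices from \<open>z\<close> to \<open>m\<close> fill one block and \<open>j\<close> opens the next, so below all
        pairs \<open>(i, m)\<close> and \<open>(z, i)\<close> are pairs within a block.\<close>
      have e1: "w i j = (x * w i m + u i * u m) + a j * w z i"
        unfolding w_def uj vj by (simp add: algebra_simps)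
      have e2: "x * w i j - u i * u j = x * (x * w i m) + a j * (x * w z i + u z * u i)"
        unfolding w_def uj vj by (simp add: algebra_simps)
      have m0: "x * w i m + u i * u m \<ge> 0"
      proof (cases "i = m")
        case True then show ?thesis by (simp add: self)
      next
        case False
        then show ?thesis using IHm im same[of i] same[of m] zi zm by auto
      qed
      have m1: "w i j \<ge> 0" unfolding e1 using m0 IHz apos by simp
      have "w i m \<ge> 0" using IHm im by (cases "i = m") (auto simp: self)
      moreover have "x * w z i + u z * u i > 0" using IHz same[of i] zi im by auto
      ultimately have "x * w i j - u i * u j > 0" unfolding e2
        using x apos by (simp add: add_nonneg_pos)
      moreover have "i div Suc p \<noteq> j div Suc p" using same[of i] zi im zdiv by simp
      ultimately show ?thesis using m1 by auto
    next
      case False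
      have uj: "u j = u m - a j * u z" and vj: "v j = v m - a j * v z"
        using u1[OF jp] v1[OF jp] False by (auto simp: m_def z_def)
      have mj: "m div Suc p = j div Suc p" using False j by (simp add: div_Suc dvd_eq_mod_eq_0)
      have mp: "m > p" using False j jp by (metis Suc_lessI dvd_refl less_SucE)
      have zi_or: "i div Suc p = z div Suc p \<or> i div Suc p = j div Suc p"
        using zdiv div_le_mono[of z i "Suc p"] div_le_mono[of i j "Suc p"] zi im j by linarith
      \<comment> \<open>Now \<open>z\<close> lies in the block before that of \<open>m\<close> and \<open>j\<close>, and \<open>i\<close> lies in one of these two blocks.
        Passing from \<open>(i, m)\<close> to \<open>(z, i)\<close> exchanges the two kinds of pairs, as the sign of the
        correction term in \<open>e2\<close> and \<open>e3\<close> demands.\<close>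
      have e1: "w i j = w i m + a j * w z i"
        unfolding w_def uj vj by (simp add: algebra_simps)
      have e2: "x * w i j + u i * u j = (x * w i m + u i * u m) + a j * (x * w z i - u z * u i)"
        unfolding w_def uj vj by (simp add: algebra_simps)
      have e3: "x * w i j - u i * u j = (x * w i m - u i * u m) + a j * (x * w z i + u z * u i)"
        unfolding w_def uj vj by (simp add: algebra_simps)
      have m1: "w i j \<ge> 0"
        unfolding e1 using IHz IHm im apos by (cases "i = m") (auto simp: self)
      have m2: "x * w i j + u i * u j > 0" if "i div Suc p = j div Suc p"
      proof -
        have "x * w i m + u i * u m \<ge> 0"
          using IHm im that mj by (cases "i = m") (auto simp: self)
        moreover have "x * w z i - u z * u i > 0" using IHz that zdiv by auto
        ultimately show ?thesis unfolding e2 using apos by (simp add: add_nonneg_pos)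
      qed
      have m3: "x * w i j - u i * u j > 0" if ne: "i div Suc p \<noteq> j div Suc p"
      proof -
        have "i < m" using ne mj im by (cases "i = m") auto
        then have "x * w i m - u i * u m > 0" using IHm ne mj by auto
        moreover have "x * w z i + u z * u i > 0" using IHz ne zi_or by auto
        ultimately show ?thesis unfolding e3 using apos by (simp add: add_pos_pos)
      qed
      show ?thesis using m1 m2 m3 by auto
    qed
  qed
qed

text \<open>A positive Wronskian makes \<open>f / g\<close> strictly decreasing wherever \<open>g \<noteq> 0\<close>. If \<open>g\<close> had no zero between
two consecutive zeros of \<open>f\<close>, the quotient would decrease from zero to zero. To the left of all zeros
of \<open>f\<close> it would decrease from a negative value to zero, and to the right of all of them it would be
negative although \<open>f\<close> and \<open>g\<close> are eventually positive.\<close>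

lemma interlacing_root:
  fixes f g :: "real poly"
  assumes W: "\<And>x. x > 0 \<Longrightarrow> poly f x * poly (pderiv g) x - poly (pderiv f) x * poly g x > 0"
    and zero: "poly f 0 * poly g 0 < 0"
    and f_pos: "eventually (\<lambda>x. poly f x > 0) at_top"
    and g_pos: "eventually (\<lambda>x. poly g x > 0) at_top"
    and r: "r = 0 \<or> r > 0 \<and> poly f r = 0"
  shows "\<exists>s>r. poly g s = 0 \<and> (\<forall>t>r. poly f t = 0 \<longrightarrow> s < t)"
proof -
  have r0: "r \<ge> 0" and gr: "poly g r \<noteq> 0" and fgr: "poly f r / poly g r \<le> 0"
    using r zero W[of r] by (auto simp: divide_le_0_iff mult_less_0_iff)
  have nz: "poly g t \<noteq> 0" if "poly f t = 0" "t > r" for t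
    using W[of t] that r0 by auto
  \<comment> \<open>As long as \<open>g\<close> has no zero, \<open>f / g\<close> decreases strictly, starting from a value \<open>\<le> 0\<close>.\<close>
  have decr: "poly f t / poly g t < 0" if t: "t > r" and no: "\<And>s. r < s \<Longrightarrow> s \<le> t \<Longrightarrow> poly g s \<noteq> 0" for t
  proof -
    have "poly f t / poly g t < poly f r / poly g r"
    proof (rule DERIV_neg_imp_decreasing_open[OF t])
      fix y assume y: "r < y" "y < t"
      let ?d = "(poly (pderiv f) y * poly g y - poly f y * poly (pderiv g) y) / (poly g y * poly g y)"
      have "((\<lambda>z. poly f z / poly g z) has_real_derivative ?d) (at y)"
        using no[of y] y by (intro DERIV_divide poly_DERIV) auto
      moreover have "?d < 0" using W[of y] y r0 no[of y]
        by (auto simp: divide_less_0_iff zero_less_mult_iff)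
      ultimately show "\<exists>d. ((\<lambda>z. poly f z / poly g z) has_real_derivative d) (at y) \<and> d < 0"
        by blast
    next
      show "continuous_on {r..t} (\<lambda>z. poly f z / poly g z)"
        using no gr by (intro continuous_intros) (metis atLeastAtMost_iff less_eq_real_def)
    qed
    with fgr show ?thesis by linarith
  qed
  show ?thesis
  proof (cases "\<exists>t>r. poly f t = 0")
    case True
    define Q where "Q = {t. t > r \<and> poly f t = 0}"
    have "f \<noteq> 0" using zero by auto
    then have "finite {t. poly f t = 0}" by (rule poly_roots_finite)
    then have fin: "finite Q" by (rule rev_finite_subset) (auto simp: Q_def)
    moreover have "Q \<noteq> {}" using True by (auto simp: Q_def)
    ultimately have t: "Min Q \<in> Q" "\<And>t. t \<in> Q \<Longrightarrow> Min Q \<le> t" by auto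
    then obtain s where s: "r < s" "s \<le> Min Q" "poly g s = 0"
      using decr[of "Min Q"] by (force simp: Q_def)
    moreover have "s \<noteq> Min Q" using s nz[of s] t(1) by (auto simp: Q_def)
    ultimately show ?thesis using t(2) by (intro exI[of _ s]) (force simp: Q_def)
  next
    case False
    have "\<exists>s>r. poly g s = 0"
    proof (rule ccontr)
      assume "\<not> ?thesis"
      moreover have ev: "eventually (\<lambda>x. poly f x > 0 \<and> poly g x > 0 \<and> x > r) at_top"
        using f_pos g_pos eventually_gt_at_top by (intro eventually_conj)
      then obtain y where "poly f y > 0" "poly g y > 0" "y > r"
        using eventually_happens[OF ev] by auto
      ultimately show False using decr[of y] by (force simp: divide_less_0_iff)
    qed
    then show ?thesis using False by auto
  qed
qed

section \<open>Zeros of the refined sequence of polynomials\<close>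

text \<open>The type II polynomials together with \<open>p\<close> intermediate polynomials after each of them. With
\<open>B = (B\<^sub>0, B\<^sub>1, \<dots>)\<close>, the entries of \<open>L\<^sub>k\<^sub>+\<^sub>1 \<cdots> L\<^sub>p U B\<close> are \<open>x\<close> times the refined polynomials with indices
\<open>n (p + 1) + k\<close>, and a single bidiagonal factor accounts for a single step of the recurrence.\<close>

fun refined_poly :: "nat \<Rightarrow> (nat \<Rightarrow> real) \<Rightarrow> nat \<Rightarrow> real poly" where
  "refined_poly p \<alpha> m = (if m \<le> p then 1
     else (if Suc p dvd m then [:0, 1:] else 1) * refined_poly p \<alpha> (m - 1)
          - Polynomial.smult (\<alpha> (m - p)) (refined_poly p \<alpha> (m - Suc p)))"

declare refined_poly.simps [simp del]

lemma div_refined_poly: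
  fixes m p :: nat
  assumes "m > p"
  shows "m div Suc p = Suc ((m - Suc p) div Suc p)"
    and "(m - 1) div Suc p = (if Suc p dvd m then m div Suc p - 1 else m div Suc p)"
proof -
  show "m div Suc p = Suc ((m - Suc p) div Suc p)"
    using assms by (simp add: le_div_geq)
  obtain k where "m = Suc k" using assms by (cases m) auto
  then show "(m - 1) div Suc p = (if Suc p dvd m then m div Suc p - 1 else m div Suc p)"
    by (simp add: div_Suc dvd_eq_mod_eq_0)
qed

lemma refined_poly_unfold:
  "m > p \<Longrightarrow> refined_poly p \<alpha> m = (if Suc p dvd m then [:0, 1:] else 1) * refined_poly p \<alpha> (m - 1)
          - Polynomial.smult (\<alpha> (m - p)) (refined_poly p \<alpha> (m - Suc p))"
  by (subst refined_poly.simps) simp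

lemma refined_poly_monic:
  "degree (refined_poly p \<alpha> m) = m div Suc p \<and> lead_coeff (refined_poly p \<alpha> m) = 1"
proof (induction m rule: less_induct)
  case (less m)
  show ?case
  proof (cases "m \<le> p")
    case True
    then show ?thesis by (simp add: refined_poly.simps)
  next
    case False
    define P where "P = (if Suc p dvd m then [:0, 1:] else 1) * refined_poly p \<alpha> (m - 1)"
    define Q where "Q = Polynomial.smult (\<alpha> (m - p)) (refined_poly p \<alpha> (m - Suc p))"
    have eq: "refined_poly p \<alpha> m = P - Q"
      using False by (subst refined_poly.simps) (simp add: P_def Q_def)
    have IH1: "degree (refined_poly p \<alpha> (m - 1)) = (m - 1) div Suc p" "lead_coeff (refined_poly p \<alpha> (m - 1)) = 1"
      using less[of "m - 1"] False by auto
    then have nz: "refined_poly p \<alpha> (m - 1) \<noteq> 0" by auto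
    have P: "degree P = m div Suc p" "lead_coeff P = 1"
      using IH1 nz div_refined_poly[of p m] False
      by (auto simp: P_def degree_mult_eq lead_coeff_mult)
    have "degree Q \<le> (m - Suc p) div Suc p"
      using less[of "m - Suc p"] False by (auto simp: Q_def)
    then have Q: "degree Q < degree P" using P div_refined_poly[of p m] False by simp
    then have "degree (P - Q) = degree P"
      by (metis degree_add_eq_left degree_minus diff_conv_add_uminus)
    then show ?thesis using P Q by (simp add: eq coeff_eq_0)
  qed
qed

text \<open>This sign pattern yields the zero of each new polynomial to the left of all zeros of its predecessor.\<close>

lemma refined_poly_at_0:
  assumes \<alpha>: "\<forall>i\<ge>1. \<alpha> i > 0"
  shows "(-1) ^ (m div Suc p) * poly (refined_poly p \<alpha> m) 0 > 0"
proof (induction m rule: less_induct)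
  case (less m)
  show ?case
  proof (cases "m \<le> p")
    case True
    then show ?thesis by (simp add: refined_poly.simps)
  next
    case False
    define c z where "c = (m - Suc p) div Suc p" and "z = m - Suc p"
    have a: "\<alpha> (m - p) > 0" using False \<alpha> by simp
    have d: "m div Suc p = Suc c" using div_refined_poly(1)[of p m] False by (simp add: c_def)
    have IHz: "(-1) ^ c * poly (refined_poly p \<alpha> z) 0 > 0"
      using less[of z] False by (simp add: c_def z_def)
    then have z: "0 < \<alpha> (m - p) * ((-1) ^ c * poly (refined_poly p \<alpha> z) 0)" using a by simp
    show ?thesis
    proof (cases "Suc p dvd m")
      case True
      then show ?thesis using z False
        by (subst refined_poly.simps) (simp add: d z_def algebra_simps)
    next
      case nd: False
      then have "(-1) ^ Suc c * poly (refined_poly p \<alpha> (m - 1)) 0 > 0"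
        using less[of "m - 1"] False div_refined_poly(2)[of p m] d by simp
      then show ?thesis using z False nd
        by (subst refined_poly.simps) (simp add: d z_def algebra_simps)
    qed
  qed
qed

text \<open>The step into a new block multiplies by \<open>x\<close> and subtracts a multiple of the first polynomial \<open>f\<close> of the
old block, which contributes nothing to a Wronskian with \<open>f\<close>. Hence the Wronskian equals that of \<open>f\<close>
with \<open>x\<close> times the last polynomial of the old block.\<close>

lemma refined_poly_block_wronskian:
  fixes p n :: nat
  assumes p: "p \<ge> 1" and \<alpha>: "\<forall>i\<ge>1. \<alpha> i > 0" and x: "x > 0"
  defines "f \<equiv> refined_poly p \<alpha> (n * Suc p)" and "g \<equiv> refined_poly p \<alpha> (Suc n * Suc p)"
  shows "poly f x * poly (pderiv g) x - poly (pderiv f) x * poly g x > 0"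
proof -
  define z m where "z = n * Suc p" and "m = z + p"
  define u v where "u = (\<lambda>j. poly (refined_poly p \<alpha> j) x)" and "v = (\<lambda>j. poly (pderiv (refined_poly p \<alpha> j)) x)"
  have u1: "u j = (if Suc p dvd j then x else 1) * u (j - 1) - \<alpha> (j - p) * u (j - Suc p)"
    and v1: "v j = (if Suc p dvd j then u (j - 1) + x * v (j - 1) else v (j - 1)) - \<alpha> (j - p) * v (j - Suc p)"
    if "j > p" for j
    using that unfolding u_def v_def
    by (subst refined_poly.simps, simp add: pderiv_diff pderiv_mult pderiv_smult pderiv_pCons)+
  have u0: "u j = 1" and v0: "v j = 0" if "j \<le> p" for j
    using that unfolding u_def v_def by (subst refined_poly.simps, simp)+
  have "m div Suc p = n" "z div Suc p = n"
    unfolding m_def z_def by (simp_all del: mult_Suc_right)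
  then have pos: "x * (u z * v m - v z * u m) + u z * u m > 0"
    using wronskian_positive[OF x, of p "\<lambda>j. \<alpha> (j - p)" u v z m] u0 v0 u1 v1 \<alpha> p
    by (auto simp: m_def)
  have jm: "Suc n * Suc p = Suc m" and jz: "Suc m - Suc p = z" and mp: "Suc m > p"
    by (simp_all add: m_def z_def)
  have dv: "Suc p dvd Suc m" unfolding jm[symmetric] by (rule dvd_triv_right)
  have us: "u (Suc m) = x * u m - \<alpha> (Suc m - p) * u z" and vs: "v (Suc m) = u m + x * v m - \<alpha> (Suc m - p) * v z"
    using u1[OF mp] v1[OF mp] dv jz by simp_all
  have "u z * v (Suc m) - v z * u (Suc m) = x * (u z * v m - v z * u m) + u z * u m"
    unfolding us vs by (simp add: algebra_simps)
  with pos show ?thesis unfolding f_def g_def jm by (simp add: u_def v_def z_def)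
qed

lemma monic_eventually_pos:
  fixes f :: "real poly"
  assumes "lead_coeff f = 1"
  shows "eventually (\<lambda>x. poly f x > 0) at_top"
  using poly_pinfty_gt_lc[of f] assms by (force simp: eventually_at_top_linorder)

lemma refined_poly_next_root:
  fixes p n :: nat
  assumes p: "p \<ge> 1" and \<alpha>: "\<forall>i\<ge>1. \<alpha> i > 0"
    and r: "r = 0 \<or> r > 0 \<and> poly (refined_poly p \<alpha> (n * Suc p)) r = 0"
  shows "\<exists>s>r. poly (refined_poly p \<alpha> (Suc n * Suc p)) s = 0 \<and>
           (\<forall>t>r. poly (refined_poly p \<alpha> (n * Suc p)) t = 0 \<longrightarrow> s < t)"
proof -
  let ?f = "refined_poly p \<alpha> (n * Suc p)" and ?g = "refined_poly p \<alpha> (Suc n * Suc p)"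
  have "(-1) ^ n * poly ?f 0 > 0" and "(-1) ^ Suc n * poly ?g 0 > 0"
    using refined_poly_at_0[OF \<alpha>, where m = "n * Suc p" and p = p]
      refined_poly_at_0[OF \<alpha>, where m = "Suc n * Suc p" and p = p]
    by (simp_all del: mult_Suc mult_Suc_right)
  then have zero: "poly ?f 0 * poly ?g 0 < 0"
    by (cases "even n") (auto simp: mult_less_0_iff zero_less_mult_iff simp del: mult_Suc mult_Suc_right)
  have ev: "eventually (\<lambda>x. poly (refined_poly p \<alpha> m) x > 0) at_top" for m
    by (rule monic_eventually_pos) (rule refined_poly_monic[THEN conjunct2])
  show ?thesis
    using interlacing_root[OF refined_poly_block_wronskian[OF p \<alpha>] zero ev ev r] .
qed

text \<open>Each of the points \<open>0\<close> and the zeros of the polynomial before has a zero of the next one strictly to its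
right, before the next such point. This gives one zero more, and the degree leaves no room for others.\<close>

lemma refined_poly_positive_roots:
  assumes p: "p \<ge> 1" and \<alpha>: "\<forall>i\<ge>1. \<alpha> i > 0"
  shows "finite {x. poly (refined_poly p \<alpha> (n * Suc p)) x = 0} \<and>
     {x. poly (refined_poly p \<alpha> (n * Suc p)) x = 0} \<subseteq> {0<..} \<and>
     card {x. poly (refined_poly p \<alpha> (n * Suc p)) x = 0} = n"
proof (induction n)
  case 0
  then show ?case by (simp add: refined_poly.simps)
next
  case (Suc n)
  let ?f = "refined_poly p \<alpha> (n * Suc p)" and ?g = "refined_poly p \<alpha> (Suc n * Suc p)"
  let ?R = "{x. poly ?f x = 0}" and ?S = "{x. poly ?g x = 0}"
  have fin: "finite ?R" and pos: "?R \<subseteq> {0<..}" and card: "card ?R = n" using Suc.IH by auto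
  have "\<forall>r\<in>insert 0 ?R. \<exists>s>r. poly ?g s = 0 \<and> (\<forall>t>r. poly ?f t = 0 \<longrightarrow> s < t)"
    using refined_poly_next_root[OF p \<alpha>, where n = n] pos by blast
  then obtain s where s: "\<And>r. r \<in> insert 0 ?R \<Longrightarrow> s r > r \<and> poly ?g (s r) = 0 \<and> (\<forall>t>r. poly ?f t = 0 \<longrightarrow> s r < t)"
    by metis
  \<comment> \<open>The new zero chosen for \<open>a\<close> lies left of \<open>b\<close>, and the one chosen for \<open>b\<close> lies right of it.\<close>
  have inj: "inj_on s (insert 0 ?R)"
  proof (rule linorder_inj_onI)
    fix a b assume ab: "a < b" "a \<in> insert 0 ?R" "b \<in> insert 0 ?R"
    then have "b \<in> ?R" using pos by auto
    then have "s a < b" using s[OF ab(2)] ab(1) by blast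
    also have "b < s b" using s[OF ab(3)] by blast
    finally show "s a \<noteq> s b" by simp
  qed auto
  have "0 \<notin> ?R" using pos by blast
  then have "card (insert 0 ?R) = Suc n" using card_insert_disjoint[OF fin] card by metis
  then have c: "card (s ` insert 0 ?R) = Suc n" using card_image[OF inj] by metis
  have sub: "s ` insert 0 ?R \<subseteq> ?S \<inter> {0<..}"
  proof (rule image_subsetI)
    fix r assume r: "r \<in> insert 0 ?R"
    then have "r \<ge> 0" using pos by auto
    then show "s r \<in> ?S \<inter> {0<..}" using s[OF r] by auto
  qed
  have g: "degree ?g = Suc n"
    using refined_poly_monic[of p \<alpha> "Suc n * Suc p"] by (metis nonzero_mult_div_cancel_right nat.distinct(1))
  then have g0: "?g \<noteq> 0" by force
  have finS: "finite ?S" using g0 by (rule poly_roots_finite)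
  have le: "card ?S \<le> card (s ` insert 0 ?R)" by (rule poly_roots_degree[OF g0, THEN order_trans]) (simp only: c g order_refl)
  have eq: "s ` insert 0 ?R = ?S"
    by (rule card_seteq[OF finS subset_trans[OF sub Int_lower1] le])
  have "?S \<subseteq> {0<..}" using sub[unfolded eq] by (rule subset_trans) (rule Int_lower2)
  moreover have "card ?S = Suc n" by (rule c[unfolded eq])
  ultimately show ?case using finS by (intro conjI)
qed

text \<open>The largest zeros increase with \<open>n\<close>, because every zero of one polynomial has a zero of the next to its
right. Beyond its largest zero a monic polynomial is positive.\<close>

lemma refined_poly_pos_beyond:
  assumes p: "p \<ge> 1" and \<alpha>: "\<forall>i\<ge>1. \<alpha> i > 0"
    and top: "\<And>s. poly (refined_poly p \<alpha> (Suc N * Suc p)) s = 0 \<Longrightarrow> s \<le> t" and n: "n \<le> N"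
  shows "poly (refined_poly p \<alpha> (n * Suc p)) t > 0"
proof -
  have nr: "poly (refined_poly p \<alpha> (n * Suc p)) s = 0 \<Longrightarrow> s < t" for s
    using n
  proof (induction n arbitrary: s rule: inc_induct)
    case base
    have "s > 0" using base refined_poly_positive_roots[OF p \<alpha>, where n = N] by blast
    then show ?case using refined_poly_next_root[OF p \<alpha>, where n = N and r = s] base top by fastforce
  next
    case (step n)
    have "s > 0" using step.prems refined_poly_positive_roots[OF p \<alpha>, where n = n] by blast
    then show ?case using refined_poly_next_root[OF p \<alpha>, where n = n and r = s] step by fastforce
  qed
  let ?f = "refined_poly p \<alpha> (n * Suc p)"
  have "eventually (\<lambda>x. poly ?f x > 0 \<and> x > t) at_top"
    using monic_eventually_pos[OF refined_poly_monic[THEN conjunct2]] eventually_gt_at_top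
    by (intro eventually_conj)
  then obtain y where y: "poly ?f y > 0" "y > t"
    using eventually_happens by force
  show ?thesis
  proof (rule ccontr)
    assume "\<not> ?thesis"
    then have "poly ?f t < 0" using nr[of t] by fastforce
    then obtain s where "t < s" "poly ?f s = 0" using poly_IVT_pos[OF y(2)] y by blast
    then show False using nr[of s] by simp
  qed
qed

section \<open>Consequences of the bidiagonal factorization\<close>

text \<open>The index counts the factors dropped at the front: \<open>0\<close> gives the whole product and \<open>p\<close> the factor \<open>U\<close>.\<close>

definition partial_prod :: "nat \<Rightarrow> (nat \<Rightarrow> real) \<Rightarrow> nat \<Rightarrow> imat" where
  "partial_prod p \<alpha> k = foldr imat_mult (map (L_factor p \<alpha>) [Suc k..<p + 1]) (U_factor p \<alpha>)"

lemma imat_mult_L_factor: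
  "imat_mult (L_factor p \<alpha> k) M i j =
     M i j + (if i = 0 then 0 else \<alpha> (k + 1 + (i - 1) * (p + 1)) * M (i - 1) j)"
proof -
  have "imat_mult (L_factor p \<alpha> k) M i j = (\<Sum>m\<in>{i - 1, i}. L_factor p \<alpha> k i m * M m j)"
    unfolding imat_mult_def by (rule sum.mono_neutral_left) (auto simp: L_factor_def split: if_splits)
  then show ?thesis by (cases i) (auto simp: L_factor_def)
qed

lemma partial_prod_rec:
  assumes "k < p"
  shows "partial_prod p \<alpha> k i j = partial_prod p \<alpha> (Suc k) i j +
     (if i = 0 then 0 else \<alpha> (Suc k + 1 + (i - 1) * (p + 1)) * partial_prod p \<alpha> (Suc k) (i - 1) j)"
proof -
  have "[Suc k..<p + 1] = Suc k # [Suc (Suc k)..<p + 1]" using assms by (simp add: upt_conv_Cons)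
  then show ?thesis by (simp only: partial_prod_def list.map foldr.simps comp_apply imat_mult_L_factor)
qed

lemma partial_prod_last: "partial_prod p \<alpha> p = U_factor p \<alpha>"
  by (simp add: partial_prod_def)

lemma partial_prod_entries:
  assumes \<alpha>: "\<forall>i\<ge>1. \<alpha> i > 0" and k: "k \<le> p"
  shows "partial_prod p \<alpha> k i j \<ge> 0 \<and> (i = j \<longrightarrow> partial_prod p \<alpha> k i j > 0) \<and>
     (j > i + 1 \<longrightarrow> partial_prod p \<alpha> k i j = 0) \<and>
     (k < p \<and> i = Suc j \<longrightarrow> partial_prod p \<alpha> k i j > 0)"
  using k
proof (induction k arbitrary: i j rule: inc_induct)
  case base
  show ?case using \<alpha>[rule_format, of "1 + j * (p + 1)"] by (auto simp: partial_prod_last U_factor_def)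
next
  case (step k)
  define a where "a = \<alpha> (Suc k + 1 + (i - 1) * (p + 1))"
  have a: "a > 0" using \<alpha> by (simp add: a_def)
  let ?M = "partial_prod p \<alpha> (Suc k)"
  have rec: "partial_prod p \<alpha> k i j = ?M i j + (if i = 0 then 0 else a * ?M (i - 1) j)"
    unfolding a_def by (rule partial_prod_rec[OF \<open>k < p\<close>])
  have ge: "?M i j \<ge> 0" "a * ?M (i - 1) j \<ge> 0"
    using step.IH[of i j] step.IH[of "i - 1" j] a by simp_all
  have "partial_prod p \<alpha> k i j > 0" if "i = j"
    using step.IH[of i j] ge that rec by (auto simp: add_pos_nonneg)
  moreover have "partial_prod p \<alpha> k i j = 0" if "j > i + 1"
    using step.IH[of i j] step.IH[of "i - 1" j] that rec by simp
  moreover have "partial_prod p \<alpha> k i j > 0" if "i = Suc j"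
    using step.IH[of j j] ge a that rec by (simp add: add_nonneg_pos)
  ultimately show ?case using ge rec by auto
qed

text \<open>Multiplication by one more factor \<open>L\<^sub>k\<close> moves every index back by one, since the refined recurrence is
the row equation of \<open>L\<^sub>k\<close> read backwards. For the whole product the indices \<open>n (p + 1)\<close> remain, and the
identity becomes the recurrence of the type II polynomials.\<close>

lemma partial_prod_refined_poly:
  assumes \<alpha>: "\<forall>i\<ge>1. \<alpha> i > 0" and k: "k \<le> p"
  shows "(\<Sum>j\<le>Suc n. Polynomial.smult (partial_prod p \<alpha> k n j) (refined_poly p \<alpha> (j * Suc p)))
     = [:0, 1:] * refined_poly p \<alpha> (n * Suc p + k)"
  using k
proof (induction k arbitrary: n rule: inc_induct)
  case base
  let ?t = "\<lambda>j. Polynomial.smult (U_factor p \<alpha> n j) (refined_poly p \<alpha> (j * Suc p))"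
  have "(\<Sum>j\<le>Suc n. ?t j) = (\<Sum>j\<in>{n, Suc n}. ?t j)"
    by (rule sum.mono_neutral_right) (auto simp: U_factor_def)
  also have "\<dots> = Polynomial.smult (\<alpha> (1 + n * (p + 1))) (refined_poly p \<alpha> (n * Suc p)) + refined_poly p \<alpha> (Suc n * Suc p)"
    by (simp add: U_factor_def)
  also have "refined_poly p \<alpha> (Suc n * Suc p) = [:0, 1:] * refined_poly p \<alpha> (n * Suc p + p)
      - Polynomial.smult (\<alpha> (1 + n * (p + 1))) (refined_poly p \<alpha> (n * Suc p))"
  proof -
    have "Suc n * Suc p > p" by simp
    moreover have "Suc n * Suc p - 1 = n * Suc p + p" "Suc n * Suc p - p = 1 + n * (p + 1)"
      "Suc n * Suc p - Suc p = n * Suc p" by simp_all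
    moreover have "Suc p dvd Suc n * Suc p" by (rule dvd_triv_right)
    ultimately show ?thesis by (simp only: refined_poly_unfold if_True)
  qed
  finally show ?case by (simp only: partial_prod_last diff_add_cancel add.commute)
next
  case (step k)
  let ?M = "partial_prod p \<alpha> (Suc k)" and ?g = "\<lambda>j. refined_poly p \<alpha> (j * Suc p)"
  show ?case
  proof (cases n)
    case 0
    have "refined_poly p \<alpha> (Suc k) = 1" "refined_poly p \<alpha> k = 1" using \<open>k < p\<close> by (simp_all add: refined_poly.simps)
    then show ?thesis using step.IH[of 0] 0 by (simp add: partial_prod_rec[OF \<open>k < p\<close>])
  next
    case (Suc n')
    define a where "a = \<alpha> (Suc k + 1 + n' * (p + 1))"
    have "(\<Sum>j\<le>Suc n. Polynomial.smult (partial_prod p \<alpha> k n j) (?g j)) =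
       (\<Sum>j\<le>Suc n. Polynomial.smult (?M n j) (?g j)) +
       Polynomial.smult a (\<Sum>j\<le>Suc n. Polynomial.smult (?M n' j) (?g j))"
      by (simp only: partial_prod_rec[OF \<open>k < p\<close>] Suc)
         (simp add: a_def smult_add_left smult_sum2 sum.distrib del: sum.atMost_Suc)
    also have "(\<Sum>j\<le>Suc n. Polynomial.smult (?M n' j) (?g j)) = (\<Sum>j\<le>Suc n'. Polynomial.smult (?M n' j) (?g j))"
      using partial_prod_entries[OF \<alpha>, of "Suc k" p n' "Suc n"] \<open>k < p\<close> Suc by simp
    also have "(\<Sum>j\<le>Suc n. Polynomial.smult (?M n j) (?g j)) +
       Polynomial.smult a (\<Sum>j\<le>Suc n'. Polynomial.smult (?M n' j) (?g j)) =
      [:0, 1:] * (refined_poly p \<alpha> (n * Suc p + Suc k) + Polynomial.smult a (refined_poly p \<alpha> (n' * Suc p + Suc k)))"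
      by (simp only: step.IH) (simp add: algebra_simps)
    also have "refined_poly p \<alpha> (n * Suc p + Suc k) + Polynomial.smult a (refined_poly p \<alpha> (n' * Suc p + Suc k)) =
       refined_poly p \<alpha> (n * Suc p + k)"
    proof -
      have "\<not> Suc p dvd n * Suc p + Suc k"
        using \<open>k < p\<close> by (metis dvd_add_right_iff dvd_triv_right nat_dvd_not_less Suc_less_eq zero_less_Suc)
      moreover have "n * Suc p + Suc k - 1 = n * Suc p + k"
        "n * Suc p + Suc k - p = Suc k + 1 + n' * (p + 1)"
        "n * Suc p + Suc k - Suc p = n' * Suc p + Suc k" "n * Suc p + Suc k > p"
        by (simp_all add: Suc)
      ultimately show ?thesis by (simp only: refined_poly_unfold[of p "n * Suc p + Suc k"] if_False a_def mult_1_left diff_add_cancel)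
    qed
    finally show ?thesis .
  qed
qed

lemma factorization_partial_prod:
  assumes "positive_bidiagonal_factorization p T"
  obtains \<alpha> where "\<forall>i\<ge>1. \<alpha> i > 0" and "T = partial_prod p \<alpha> 0"
  using assms that unfolding positive_bidiagonal_factorization_def partial_prod_def
  by (metis One_nat_def)

lemma Hessenberg_nonneg:
  assumes p: "p \<ge> 1" and T: "positive_bidiagonal_factorization p T"
  shows "T i j \<ge> 0" and "T (Suc i) i > 0"
proof -
  obtain \<alpha> where \<alpha>: "\<forall>i\<ge>1. \<alpha> i > 0" and eq: "T = partial_prod p \<alpha> 0"
    using factorization_partial_prod[OF T] .
  show "T i j \<ge> 0" "T (Suc i) i > 0"
    using partial_prod_entries[of \<alpha> 0 p i j] partial_prod_entries[of \<alpha> 0 p "Suc i" i] \<alpha> p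
    by (auto simp: eq)
qed

text \<open>The vector of type II polynomials is a formal eigenvector of the semi-infinite matrix. The index sets of
the defining recurrence may be enlarged because the additional entries of the band matrix vanish.\<close>

lemma B_poly_recurrence:
  assumes T: "banded_hessenberg p T"
  shows "(\<Sum>j\<le>Suc n. Polynomial.smult (T n j) (B_poly p T j)) = [:0, 1:] * B_poly p T n"
proof -
  have "(\<Sum>j<n. Polynomial.smult (T n j) (B_poly p T j)) = (\<Sum>j\<in>{n - p..<n}. Polynomial.smult (T n j) (B_poly p T j))"
    using T by (intro sum.mono_neutral_right) (auto simp: banded_hessenberg_def)
  moreover have "T n (Suc n) = 1" using T by (simp add: banded_hessenberg_def)
  ultimately show ?thesis
    by (simp add: lessThan_Suc_atMost[symmetric] algebra_simps)
qed

lemma B_poly_eq_refined_poly: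
  assumes T: "banded_hessenberg p T" and \<alpha>: "\<forall>i\<ge>1. \<alpha> i > 0" and eq: "T = partial_prod p \<alpha> 0"
  shows "B_poly p T n = refined_poly p \<alpha> (n * Suc p)"
proof (induction n rule: less_induct)
  case (less n)
  show ?case
  proof (cases n)
    case 0
    then show ?thesis by (simp add: refined_poly.simps)
  next
    case (Suc m)
    let ?g = "\<lambda>j. refined_poly p \<alpha> (j * Suc p)"
    have "T m (Suc m) = 1" using T by (simp add: banded_hessenberg_def)
    moreover have "(\<Sum>j\<le>m. Polynomial.smult (T m j) (B_poly p T j)) = (\<Sum>j\<le>m. Polynomial.smult (T m j) (?g j))"
      using less Suc by (intro sum.cong) auto
    moreover have "(\<Sum>j\<le>Suc m. Polynomial.smult (T m j) (?g j)) = [:0, 1:] * ?g m"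
      using partial_prod_refined_poly[of \<alpha> 0 p m] \<alpha> eq by simp
    ultimately show ?thesis
      using B_poly_recurrence[OF T, of m] less[of m] Suc by (simp del: mult_Suc mult_Suc_right)
  qed
qed

lemma B_poly_zeros:
  fixes p N :: nat and T :: imat
  assumes p: "p \<ge> 1" and T: "banded_hessenberg p T" and fac: "positive_bidiagonal_factorization p T"
  defines "Z \<equiv> {x. poly (B_poly p T (N + 1)) x = 0}"
  shows "finite Z" and "card Z = N + 1"
    and "(\<And>s. s \<in> Z \<Longrightarrow> s \<le> t) \<Longrightarrow> n \<le> N \<Longrightarrow> poly (B_poly p T n) t > 0"
proof -
  obtain \<alpha> where \<alpha>: "\<forall>i\<ge>1. \<alpha> i > 0" and eq: "T = partial_prod p \<alpha> 0"
    using factorization_partial_prod[OF fac] .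
  have B: "B_poly p T n = refined_poly p \<alpha> (n * Suc p)" for n by (rule B_poly_eq_refined_poly[OF T \<alpha> eq])
  show "finite Z" "card Z = N + 1"
    using refined_poly_positive_roots[OF p \<alpha>, where n = "N + 1"] unfolding Z_def B by auto
  show "(\<And>s. s \<in> Z \<Longrightarrow> s \<le> t) \<Longrightarrow> n \<le> N \<Longrightarrow> poly (B_poly p T n) t > 0"
    using refined_poly_pos_beyond[OF p \<alpha>, where N = N] unfolding Z_def B by simp
qed

section \<open>Truncated polynomials at the largest zero\<close>

text \<open>A Perron-Frobenius argument. If \<open>lam\<close> were an eigenvalue of a proper trailing block, the absolute values
of a left eigenvector of that block, extended by zeros, would form a nonnegative row vector \<open>z\<close> with
\<open>lam z \<le> z T\<close>. Pairing with a positive right eigenvector for \<open>lam\<close> leaves no room for strict inequality, so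
\<open>z\<close> is a left eigenvector. It vanishes at index \<open>0\<close>, and the positive subdiagonal carries this to all
indices.\<close>

lemma B_trunc_nonzero:
  fixes T :: imat and lam :: real and u :: "nat \<Rightarrow> real"
  assumes nonneg: "\<And>i j. T i j \<ge> 0" and sub: "\<And>i. T (Suc i) i > 0"
    and u: "\<And>i. i \<le> N \<Longrightarrow> u i > 0"
    and eig: "\<And>i. i \<le> N \<Longrightarrow> (\<Sum>j<Suc N. T i j * u j) = lam * u i"
    and m: "1 \<le> m" "m \<le> N + 1"
  shows "poly (B_trunc T N m) lam \<noteq> 0"
proof (cases "m = N + 1")
  case True
  then show ?thesis using B_trunc_last[of T N] by simp
next
  case False
  with m have mN: "m \<le> N" by simp
  define q where "q = N + 1 - m"
  define C where "C = trunc_mat_from T N m"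
  have C: "C \<in> carrier_mat q q" by (simp add: C_def trunc_mat_from_def q_def)
  show ?thesis
  proof
    assume "poly (B_trunc T N m) lam = 0"
    then have "poly (char_poly (transpose_mat C)) lam = 0"
      using C by (simp add: B_trunc_def C_def)
    then have "eigenvalue (transpose_mat C) lam"
      using C by (simp add: eigenvalue_root_char_poly[of _ q])
    then obtain v where v: "v \<in> carrier_vec q" "v \<noteq> 0\<^sub>v q" "transpose_mat C *\<^sub>v v = lam \<cdot>\<^sub>v v"
      using C unfolding eigenvalue_def eigenvector_def by auto
    \<comment> \<open>The absolute values of \<open>v\<close>, extended by zeros to all indices, satisfy the left eigenvector equation of
      the whole matrix up to an inequality.\<close>
    define z where "z i = (if m \<le> i then \<bar>v $ (i - m)\<bar> else 0)" for i
    have z0: "z i \<ge> 0" for i by (simp add: z_def)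
    have shift: "(\<Sum>i<Suc N. z i * T i j) = (\<Sum>i<q. \<bar>v $ i\<bar> * T (m + i) j)" for j
    proof -
      have "(\<Sum>i<Suc N. z i * T i j) = (\<Sum>i\<in>{m..<Suc N}. z i * T i j)"
        by (rule sum.mono_neutral_right) (auto simp: z_def)
      also have "\<dots> = (\<Sum>i<q. z (m + i) * T (m + i) j)"
        using mN by (intro sum.reindex_bij_witness[of _ "\<lambda>i. m + i" "\<lambda>i. i - m"]) (auto simp: q_def)
      finally show ?thesis by (simp add: z_def)
    qed
    have ge: "(\<Sum>i<Suc N. z i * T i j) - lam * z j \<ge> 0" if j: "j \<le> N" for j
    proof (cases "m \<le> j")
      case False
      then have "z j = 0" by (simp add: z_def)
      then show ?thesis using nonneg z0 by (simp add: sum_nonneg)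
    next
      case True
      define j' where "j' = j - m"
      have j': "j = m + j'" "j' < q" using True j by (auto simp: j'_def q_def)
      have "lam * v $ j' = (transpose_mat C *\<^sub>v v) $ j'" using v j' by simp
      also have "\<dots> = (\<Sum>i<q. T (m + i) j * v $ i)"
        using C v(1) j' by (simp add: scalar_prod_def lessThan_atLeast0 C_def trunc_mat_from_def q_def)
      finally have "\<bar>lam * v $ j'\<bar> \<le> (\<Sum>i<q. \<bar>T (m + i) j * v $ i\<bar>)" by (simp only: sum_abs)
      also have "\<dots> = (\<Sum>i<q. \<bar>v $ i\<bar> * T (m + i) j)"
        using nonneg by (simp add: abs_mult mult.commute)
      finally have "\<bar>lam * v $ j'\<bar> \<le> (\<Sum>i<Suc N. z i * T i j)" by (simp only: shift)
      moreover have "lam * z j \<le> \<bar>lam * v $ j'\<bar>"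
        unfolding j'(1) z_def by (simp add: abs_mult mult_right_mono)
      ultimately show ?thesis by linarith
    qed
    \<comment> \<open>Pairing with the positive right eigenvector shows that the defects sum to zero.\<close>
    have "(\<Sum>j<Suc N. u j * ((\<Sum>i<Suc N. z i * T i j) - lam * z j)) =
        (\<Sum>j<Suc N. \<Sum>i<Suc N. z i * (T i j * u j)) - (\<Sum>j<Suc N. z j * (lam * u j))"
      by (simp only: right_diff_distrib sum_subtractf sum_distrib_left) (simp add: mult_ac)
    also have "(\<Sum>j<Suc N. \<Sum>i<Suc N. z i * (T i j * u j)) = (\<Sum>i<Suc N. z i * (\<Sum>j<Suc N. T i j * u j))"
      by (subst sum.swap) (simp only: sum_distrib_left)
    also have "\<dots> = (\<Sum>i<Suc N. z i * (lam * u i))"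
      by (rule sum.cong) (simp_all only: eig less_Suc_eq_le lessThan_iff)
    finally have tot: "(\<Sum>j<Suc N. u j * ((\<Sum>i<Suc N. z i * T i j) - lam * z j)) = 0" by simp
    have nn: "u j * ((\<Sum>i<Suc N. z i * T i j) - lam * z j) \<ge> 0" if "j \<in> {..<Suc N}" for j
      using ge[of j] u[of j] that
      by (intro mult_nonneg_nonneg) (simp_all add: less_Suc_eq_le less_imp_le del: sum.lessThan_Suc)
    have eq: "(\<Sum>i<Suc N. z i * T i j) = lam * z j" if "j \<le> N" for j
    proof -
      have "u j * ((\<Sum>i<Suc N. z i * T i j) - lam * z j) = 0"
        by (rule sum_nonneg_0[OF finite_lessThan nn tot]) (use that in simp_all)
      then show ?thesis using u[OF that] by (simp del: sum.lessThan_Suc)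
    qed
    \<comment> \<open>The zero entries at the top propagate downwards through the positive subdiagonal.\<close>
    have zz: "z i = 0" if "i \<le> N" for i
      using that
    proof (induction i)
      case 0
      then show ?case using m by (simp add: z_def)
    next
      case (Suc i)
      have "z (Suc i) * T (Suc i) i \<le> (\<Sum>i'<Suc N. z i' * T i' i)"
        using Suc.prems nonneg z0 by (intro member_le_sum) auto
      also have "\<dots> = 0" using eq[of i] Suc by simp
      finally show ?case using sub[of i] z0[of "Suc i"] by (simp add: mult_le_0_iff)
    qed
    have "v = 0\<^sub>v q"
    proof (rule eq_vecI)
      fix i assume "i < dim_vec (0\<^sub>v q :: real vec)"
      then show "v $ i = 0\<^sub>v q $ i" using zz[of "m + i"] by (simp add: z_def q_def)
    qed (use v in simp)
    then show False using v by simp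
  qed
qed

section \<open>Inverses and powers of matrices\<close>

lemma mat_inv_eqI:
  assumes A: "A \<in> carrier_mat n n" and B: "B \<in> carrier_mat n n"
    and AB: "A * B = 1\<^sub>m n" and BA: "B * A = 1\<^sub>m n"
  shows "mat_inv A = B"
proof (cases "mat_inverse A")
  case None
  have "A \<in> Units (ring_mat TYPE(real) n ())"
    using A B AB BA unfolding Units_def ring_mat_simps by auto
  then show ?thesis using mat_inverse(1)[OF A None, of "()"] by blast
next
  case (Some C)
  then have C: "A * C = 1\<^sub>m n" "C \<in> carrier_mat n n" using mat_inverse(2)[OF A Some] by auto
  have "C = (B * A) * C" using BA C by simp
  also have "\<dots> = B" using A B C by (simp add: assoc_mult_mat[of B n n A n C n])
  finally show ?thesis by (simp add: mat_inv_def Some)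
qed

lemma mat_inv_det:
  fixes A :: "real mat"
  assumes A: "A \<in> carrier_mat n n" and det: "det A \<noteq> 0"
  shows "A * mat_inv A = 1\<^sub>m n" and "mat_inv A * A = 1\<^sub>m n" and "mat_inv A \<in> carrier_mat n n"
proof -
  have "A \<in> Units (ring_mat TYPE(real) n ())" by (rule det_non_zero_imp_unit[OF A det])
  then obtain B where "B \<in> carrier_mat n n" "A * B = 1\<^sub>m n" "B * A = 1\<^sub>m n"
    unfolding Units_def ring_mat_simps by auto
  with mat_inv_eqI[OF A]
  show "A * mat_inv A = 1\<^sub>m n" and "mat_inv A * A = 1\<^sub>m n" and "mat_inv A \<in> carrier_mat n n"
    by auto
qed

lemma mat_inv_diag:
  assumes "\<And>i. i < n \<Longrightarrow> f i \<noteq> 0"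
  shows "mat_inv (mat_diag n f) = mat_diag n (\<lambda>i. 1 / f i)"
proof (rule mat_inv_eqI)
  have "mat_diag n (\<lambda>i. f i * (1 / f i)) = 1\<^sub>m n"
    using assms by (intro eq_matI) (auto simp: mat_diag_def)
  then show "mat_diag n f * mat_diag n (\<lambda>i. 1 / f i) = 1\<^sub>m n"
    "mat_diag n (\<lambda>i. 1 / f i) * mat_diag n f = 1\<^sub>m n"
    by (simp_all add: mult.commute)
qed auto

lemma diag_conj_pow:
  fixes f :: "nat \<Rightarrow> real"
  assumes M: "M \<in> carrier_mat n n" and f: "\<And>i. i < n \<Longrightarrow> f i \<noteq> 0" and ij: "i < n" "j < n"
  shows "((mat_diag n f * M * mat_diag n (\<lambda>i. 1 / f i)) ^\<^sub>m m) $$ (i, j) = f i * (M ^\<^sub>m m) $$ (i, j) / f j"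
proof -
  let ?D = "mat_diag n f" and ?D' = "mat_diag n (\<lambda>i. 1 / f i)"
  have "mat_diag n (\<lambda>i. f i * (1 / f i)) = 1\<^sub>m n"
    using f by (intro eq_matI) (auto simp: mat_diag_def)
  moreover have "?D * M * ?D' \<in> carrier_mat n n" using M by (metis mat_diag_dim mult_carrier_mat)
  ultimately have "similar_mat_wit (?D * M * ?D') M ?D ?D'"
    using M by (intro similar_mat_witI[of _ _ n]) (auto simp: mult.commute)
  then have "(?D * M * ?D') ^\<^sub>m m = ?D * M ^\<^sub>m m * ?D'" by (rule similar_mat_wit_pow_id)
  moreover have "M ^\<^sub>m m \<in> carrier_mat n n" using M by (rule pow_carrier_mat)
  ultimately show ?thesis using ij
    by (simp add: mat_diag_mult_left[of _ n n] mat_diag_mult_right[of _ n n])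
qed

lemma mat_diag_pow: "mat_diag n f ^\<^sub>m m = mat_diag n (\<lambda>i. f i ^ m :: real)"
  by (induction m) (simp_all add: mult.commute, simp add: mat_diag_def)

text \<open>The eigenvectors are the columns of \<open>E\<close> and the rows of its inverse \<open>W\<close>.\<close>

lemma spectral_pow_entry:
  assumes A: "A \<in> carrier_mat n n" and E: "E \<in> carrier_mat n n" and W: "W \<in> carrier_mat n n"
    and EW: "E * W = 1\<^sub>m n" and WE: "W * E = 1\<^sub>m n" and AE: "A * E = E * mat_diag n (f :: nat \<Rightarrow> real)"
    and ij: "i < n" "j < n"
  shows "(A ^\<^sub>m m) $$ (i, j) = (\<Sum>r<n. E $$ (i, r) * f r ^ m * W $$ (r, j))"
proof -
  have "E * mat_diag n f * W = A * (E * W)"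
    using A E W by (simp add: AE[symmetric] assoc_mult_mat[of A n n E n W n])
  also have "\<dots> = A" using EW A by simp
  finally have "similar_mat_wit A (mat_diag n f) E W"
    using A E W EW WE by (intro similar_mat_witI[of _ _ n]) auto
  then have "A ^\<^sub>m m = E * mat_diag n (\<lambda>r. f r ^ m) * W"
    by (simp add: similar_mat_wit_pow_id mat_diag_pow)
  then show ?thesis using ij E W
    by (simp add: mat_diag_mult_right[of _ n n] scalar_prod_def lessThan_atLeast0)
qed

lemma transpose_pow:
  assumes A: "A \<in> carrier_mat n n"
  shows "transpose_mat A ^\<^sub>m m = transpose_mat ((A :: real mat) ^\<^sub>m m)"
proof (induction m)
  case (Suc m)
  have Am: "A ^\<^sub>m m \<in> carrier_mat n n" using A by (rule pow_carrier_mat)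
  have comm: "A * A ^\<^sub>m k = A ^\<^sub>m k * A" for k
  proof (induction k)
    case (Suc k)
    have "A ^\<^sub>m k \<in> carrier_mat n n" using A by (rule pow_carrier_mat)
    then show ?case using A Suc by (simp add: assoc_mult_mat[of A n n "A ^\<^sub>m k" n A n, symmetric])
  qed (use A in simp)
  have "transpose_mat A ^\<^sub>m Suc m = transpose_mat (A * A ^\<^sub>m m)"
    using Suc transpose_mult[OF A Am] by simp
  then show ?case by (simp add: comm)
qed (use A in simp)

section \<open>Eigenvectors of the truncated matrix\<close>

lemma B_poly_monic:
  "degree (B_poly p T n) = n \<and> lead_coeff (B_poly p T n) = 1"
proof (induction n rule: less_induct)
  case (less n)
  show ?case
  proof (cases n)
    case (Suc m)
    let ?P = "[:- T m m, 1:] * B_poly p T m"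
    let ?S = "\<Sum>j\<in>{m - p..<m}. Polynomial.smult (T m j) (B_poly p T j)"
    have m: "degree (B_poly p T m) = m" "lead_coeff (B_poly p T m) = 1" using less[of m] Suc by (metis lessI)+
    then have nz: "B_poly p T m \<noteq> 0" by auto
    have P: "degree ?P = Suc m" using m(1) nz by (simp add: degree_mult_eq del: mult_pCons_left)
    have "lead_coeff ?P = lead_coeff [:- T m m, 1:] * lead_coeff (B_poly p T m)" by (rule lead_coeff_mult)
    then have lead: "lead_coeff ?P = 1" unfolding m(2) by simp
    have "degree (Polynomial.smult (T m j) (B_poly p T j)) \<le> m" if "j \<in> {m - p..<m}" for j
      using that less[of j] Suc by simp
    then have "degree ?S \<le> m" by (intro degree_sum_le) auto
    then have S: "degree ?S < degree ?P" using P by simp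
    then have "degree (?P - ?S) = degree ?P"
      by (metis degree_add_eq_left degree_minus diff_conv_add_uminus)
    then show ?thesis using P lead S unfolding Suc B_poly.simps by (simp add: coeff_eq_0 del: mult_pCons_left)
  qed simp
qed

declare B_poly.simps(2) [simp del]

lemma B_poly_independent:
  assumes "(\<Sum>i<n. Polynomial.smult (c i) (B_poly p T i)) = 0" and "i < n"
  shows "c i = 0"
  using assms
proof (induction n arbitrary: i)
  case (Suc n)
  have low: "coeff (B_poly p T j) n = 0" if "j < n" for j
    using that B_poly_monic[of p T j] by (simp add: coeff_eq_0)
  have "coeff (B_poly p T n) n = 1" using B_poly_monic[of p T n] by metis
  then have "coeff (\<Sum>i<Suc n. Polynomial.smult (c i) (B_poly p T i)) n = c n"
    using low by (simp add: coeff_sum)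
  then have cn: "c n = 0" unfolding Suc.prems(1) by simp
  then show ?case using Suc by (cases "i = n") auto
qed simp

text \<open>The list of decreasing zeros has no gaps once the number of zeros is known, so that every index in range
refers to a zero.\<close>

lemma zero_B_enum:
  fixes p N :: nat and T :: imat
  defines "Z \<equiv> {x. poly (B_poly p T (N + 1)) x = 0}"
  assumes fin: "finite Z" and card: "card Z = N + 1"
  shows "bij_betw (\<lambda>r. zero_B p T N (Suc r)) {..<N + 1} Z"
    and "s \<in> Z \<Longrightarrow> s \<le> zero_B p T N 1"
proof -
  define xs where "xs = sorted_list_of_set Z"
  have xs: "set xs = Z" "distinct xs" "sorted xs" "length xs = N + 1"
    using fin card by (simp_all add: xs_def)
  have zero: "zero_B p T N (Suc r) = rev xs ! r" for r
    by (simp add: zero_B_def xs_def Z_def)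
  show "bij_betw (\<lambda>r. zero_B p T N (Suc r)) {..<N + 1} Z"
    unfolding zero using xs by (intro bij_betw_nth) auto
  assume "s \<in> Z"
  then obtain i where i: "i < N + 1" "s = xs ! i" using xs by (metis in_set_conv_nth)
  then have "s \<le> xs ! N" using xs by (auto intro: sorted_nth_mono)
  also have "\<dots> = zero_B p T N 1" using zero[of 0] xs by (simp add: rev_nth)
  finally show "s \<le> zero_B p T N 1" .
qed

lemma eigvec_mat_carrier: "eigvec_mat p T N \<in> carrier_mat (N + 1) (N + 1)"
  by (simp add: eigvec_mat_def)

lemma trunc_mat_carrier: "trunc_mat T N \<in> carrier_mat (N + 1) (N + 1)"
  by (simp add: trunc_mat_def)

text \<open>A linear relation between the rows is a polynomial of degree at most \<open>N\<close> with \<open>N + 1\<close> zeros, hence the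
zero polynomial, and the type II polynomials are linearly independent.\<close>

lemma eigvec_mat_det:
  fixes p N :: nat and T :: imat
  defines "Z \<equiv> {x. poly (B_poly p T (N + 1)) x = 0}"
  assumes fin: "finite Z" and card: "card Z = N + 1"
  shows "det (eigvec_mat p T N) \<noteq> 0"
proof
  let ?E = "eigvec_mat p T N"
  assume "det ?E = 0"
  then have "det (transpose_mat ?E) = 0" using det_transpose[OF eigvec_mat_carrier] by simp
  then obtain v where v: "v \<in> carrier_vec (N + 1)" "v \<noteq> 0\<^sub>v (N + 1)"
      "transpose_mat ?E *\<^sub>v v = 0\<^sub>v (N + 1)"
    using det_0_iff_vec_prod_zero_field[of "transpose_mat ?E" "N + 1"]
    by (auto simp: eigvec_mat_def)
  define g where "g = (\<Sum>i<N + 1. Polynomial.smult (v $ i) (B_poly p T i))"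
  have "poly g (zero_B p T N (Suc r)) = (transpose_mat ?E *\<^sub>v v) $ r" if "r < N + 1" for r
    using that v(1) by (simp add: g_def poly_sum scalar_prod_def lessThan_atLeast0 eigvec_mat_def mult.commute)
  then have g_zero: "poly g (zero_B p T N (Suc r)) = 0" if "r < N + 1" for r
    using that v by simp
  have "Z = (\<lambda>r. zero_B p T N (Suc r)) ` {..<N + 1}"
    using zero_B_enum(1)[OF fin[unfolded Z_def] card[unfolded Z_def]]
    by (simp add: bij_betw_def Z_def)
  then have sub: "Z \<subseteq> {x. poly g x = 0}" using g_zero by auto
  have deg: "degree g \<le> N"
    unfolding g_def by (rule degree_sum_le) (auto simp: B_poly_monic)
  have "g = 0"
  proof (rule ccontr)
    assume "g \<noteq> 0"
    then have "card Z \<le> degree g"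
      using card_mono[OF poly_roots_finite sub] poly_roots_degree[of g] by simp
    then show False using deg card by simp
  qed
  then have "v $ i = 0" if "i < N + 1" for i
    using B_poly_independent[of "($) v" p T "N + 1" i] that by (simp add: g_def)
  then have "v = 0\<^sub>v (N + 1)" using v by (intro eq_vecI) auto
  with v show False by simp
qed

lemma B_poly_eigenvector:
  assumes T: "banded_hessenberg p T" and x: "poly (B_poly p T (N + 1)) x = 0" and i: "i \<le> N"
  shows "(\<Sum>j<Suc N. T i j * poly (B_poly p T j) x) = x * poly (B_poly p T i) x"
proof -
  let ?b = "\<lambda>j. T i j * poly (B_poly p T j) x"
  have "x * poly (B_poly p T i) x = (\<Sum>j\<le>Suc i. ?b j)"
    using arg_cong[OF B_poly_recurrence[OF T, of i], of "\<lambda>q. poly q x"]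
    by (simp only: poly_sum poly_smult poly_mult) simp
  also have "\<dots> = (\<Sum>j\<le>Suc N. ?b j)"
    using T i by (intro sum.mono_neutral_left) (auto simp: banded_hessenberg_def)
  also have "\<dots> = (\<Sum>j<Suc N. ?b j)" using x by (simp add: lessThan_Suc_atMost)
  finally show ?thesis by simp
qed

lemma trunc_mat_eigvec_mat:
  assumes T: "banded_hessenberg p T"
    and Z: "\<And>r. r \<le> N \<Longrightarrow> poly (B_poly p T (N + 1)) (zero_B p T N (Suc r)) = 0"
  shows "trunc_mat T N * eigvec_mat p T N =
     eigvec_mat p T N * mat_diag (N + 1) (\<lambda>r. zero_B p T N (Suc r))"
proof (rule eq_matI)
  fix i r
  assume "i < dim_row (eigvec_mat p T N * mat_diag (N + 1) (\<lambda>r. zero_B p T N (Suc r)))"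
    and "r < dim_col (eigvec_mat p T N * mat_diag (N + 1) (\<lambda>r. zero_B p T N (Suc r)))"
  then have ir: "i \<le> N" "r \<le> N" by (auto simp: eigvec_mat_def mat_diag_def)
  then have "(trunc_mat T N * eigvec_mat p T N) $$ (i, r) =
      (\<Sum>j<Suc N. T i j * poly (B_poly p T j) (zero_B p T N (Suc r)))"
    by (simp add: trunc_mat_def eigvec_mat_def scalar_prod_def lessThan_atLeast0)
  also have "\<dots> = zero_B p T N (Suc r) * poly (B_poly p T i) (zero_B p T N (Suc r))"
    by (rule B_poly_eigenvector[OF T Z ir(1)]) (rule ir)
  finally show "(trunc_mat T N * eigvec_mat p T N) $$ (i, r) =
      (eigvec_mat p T N * mat_diag (N + 1) (\<lambda>r. zero_B p T N (Suc r))) $$ (i, r)"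
    unfolding mat_diag_mult_right[OF eigvec_mat_carrier] using ir by (simp add: eigvec_mat_def)
qed (simp_all add: trunc_mat_def eigvec_mat_def mat_diag_def)

section \<open>Masses and type I polynomials\<close>

text \<open>The outermost diagonal of the band does not vanish, so each column equation determines the entry with the
largest index. Only columns whose band lies inside the truncated matrix are used, so that the same argument
applies to a left eigenvector of the truncated matrix and to a solution of the semi-infinite recurrence.\<close>

lemma banded_left_recursion_unique:
  fixes w w' :: "nat \<Rightarrow> real" and T :: imat
  assumes p: "p \<ge> 1" and T: "\<And>n. T (n + p) n \<noteq> 0"
    and init: "\<And>j. j < p \<Longrightarrow> w j = w' j"
    and w: "\<And>n. n + p \<le> N \<Longrightarrow> (if n = 0 then 0 else w (n - 1)) + (\<Sum>i\<in>{0..p}. T (n + i) n * w (n + i)) = x * w n"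
    and w': "\<And>n. n + p \<le> N \<Longrightarrow> (if n = 0 then 0 else w' (n - 1)) + (\<Sum>i\<in>{0..p}. T (n + i) n * w' (n + i)) = x * w' n"
    and l: "l \<le> N"
  shows "w l = w' l"
  using l
proof (induction l rule: less_induct)
  case (less l)
  show ?case
  proof (cases "l < p")
    case False
    define n where "n = l - p"
    have l: "l = n + p" using False by (simp add: n_def)
    have n: "n + p \<le> N" using less.prems l by simp
    have IH: "w j = w' j" if "j < l" for j using less that by simp
    have split: "(\<Sum>i\<in>{0..p}. f i) = (\<Sum>i\<in>{0..<p}. f i) + f p" for f :: "nat \<Rightarrow> real"
      by (simp add: atLeastLessThanSuc_atLeastAtMost[symmetric])
    have "(\<Sum>i\<in>{0..<p}. T (n + i) n * w (n + i)) = (\<Sum>i\<in>{0..<p}. T (n + i) n * w' (n + i))"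
      using IH l by (intro sum.cong) auto
    moreover have "w (n - 1) = w' (n - 1)" "w n = w' n" using IH p l by auto
    ultimately have "T (n + p) n * w (n + p) = T (n + p) n * w' (n + p)"
      using w[OF n] w'[OF n] unfolding split by (smt (verit))
    then show ?thesis using T l by simp
  qed (simp add: init)
qed

lemma left_eigvec_recursion:
  fixes w :: "nat \<Rightarrow> real"
  assumes T: "banded_hessenberg p T" and n: "n + p \<le> N"
    and eig: "(\<Sum>i<Suc N. w i * T i n) = x * w n"
  shows "(if n = 0 then 0 else w (n - 1)) + (\<Sum>i\<in>{0..p}. T (n + i) n * w (n + i)) = x * w n"
proof -
  have "(\<Sum>i<Suc N. w i * T i n) = (\<Sum>i\<in>{n - 1..n + p}. w i * T i n)"
    using T n by (intro sum.mono_neutral_right) (auto simp: banded_hessenberg_def)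
  also have "\<dots> = (if n = 0 then 0 else w (n - 1)) + (\<Sum>i\<in>{n..n + p}. w i * T i n)"
  proof (cases n)
    case (Suc k)
    have "T k (Suc k) = 1" using T by (simp add: banded_hessenberg_def)
    moreover have "{k..Suc k + p} = insert k {Suc k..Suc k + p}" by auto
    ultimately show ?thesis using Suc by simp
  qed simp
  also have "(\<Sum>i\<in>{n..n + p}. w i * T i n) = (\<Sum>i\<in>{0..p}. T (n + i) n * w (n + i))"
    by (rule sum.reindex_bij_witness[of _ "\<lambda>i. n + i" "\<lambda>i. i - n"]) (auto simp: mult.commute)
  finally show ?thesis using eig by simp
qed

lemma unitriangular_det:
  assumes "lower_unitriangular p \<nu>"
  shows "det \<nu> \<noteq> 0"
proof -
  have \<nu>: "\<nu> \<in> carrier_mat p p" using assms by (simp add: lower_unitriangular_def)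
  have "det \<nu> = prod_list (diag_mat \<nu>)"
    using assms by (intro det_lower_triangular[OF _ \<nu>]) (auto simp: lower_unitriangular_def)
  moreover have "set (diag_mat \<nu>) \<subseteq> {1}"
    using assms \<nu> by (auto simp: diag_mat_def lower_unitriangular_def)
  then have "0 \<notin> set (diag_mat \<nu>)" by auto
  ultimately show ?thesis by (simp add: prod_list_zero_iff)
qed

text \<open>For fixed \<open>r\<close> both sides, as functions of \<open>l\<close>, solve the left recurrence of the band matrix at the same zero,
and the masses are defined through \<open>\<nu>\<^sup>-\<^sup>1\<close> precisely so that the first \<open>p\<close> values agree.\<close>

lemma mass_typeI:
  assumes p: "p \<ge> 1" and T: "banded_hessenberg p T" and \<nu>: "lower_unitriangular p \<nu>"
    and A: "typeI_polys p T \<nu> A" and N: "N \<ge> p - 1"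
    and left: "\<And>j. j \<le> N \<Longrightarrow> (\<Sum>i<Suc N. mat_inv (eigvec_mat p T N) $$ (r, i) * T i j)
       = zero_B p T N (Suc r) * mat_inv (eigvec_mat p T N) $$ (r, j)"
    and l: "l \<le> N"
  shows "(\<Sum>a\<in>{1..p}. mass p T \<nu> N (Suc r) a * poly (A a l) (zero_B p T N (Suc r)))
     = mat_inv (eigvec_mat p T N) $$ (r, l)"
proof -
  define x where "x = zero_B p T N (Suc r)"
  define w where "w = (\<lambda>i. mat_inv (eigvec_mat p T N) $$ (r, i))"
  define \<mu> where "\<mu> = mass p T \<nu> N (Suc r)"
  define Q where "Q j = (\<Sum>a\<in>{1..p}. \<mu> a * poly (A a j) x)" for j
  have \<nu>c: "\<nu> \<in> carrier_mat p p" using \<nu> by (simp add: lower_unitriangular_def)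
  note inv = mat_inv_det[OF \<nu>c unitriangular_det[OF \<nu>]]
  have init: "Q j = w j" if j: "j < p" for j
  proof -
    have "Q j = (\<Sum>a\<in>{1..p}. \<nu> $$ (j, a - 1) * (mat_inv \<nu> *\<^sub>v vec p w) $ (a - 1))"
      using A j unfolding Q_def typeI_polys_def
      by (intro sum.cong) (simp_all add: \<mu>_def mass_def w_def mult.commute)
    also have "\<dots> = (\<Sum>b<p. \<nu> $$ (j, b) * (mat_inv \<nu> *\<^sub>v vec p w) $ b)"
      by (rule sum.reindex_bij_witness[of _ Suc "\<lambda>a. a - 1"]) auto
    also have "\<dots> = (\<nu> *\<^sub>v (mat_inv \<nu> *\<^sub>v vec p w)) $ j"
      using \<nu>c inv j by (simp add: scalar_prod_def lessThan_atLeast0)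
    also have "\<nu> *\<^sub>v (mat_inv \<nu> *\<^sub>v vec p w) = (\<nu> * mat_inv \<nu>) *\<^sub>v vec p w"
      using \<nu>c inv by (intro assoc_mult_mat_vec[symmetric]) auto
    finally show ?thesis using inv j by simp
  qed
  have rec: "(if n = 0 then 0 else Q (n - 1)) + (\<Sum>i\<in>{0..p}. T (n + i) n * Q (n + i)) = x * Q n" for n
  proof -
    have "(if n = 0 then 0 else poly (A a (n - 1)) x) + (\<Sum>i\<in>{0..p}. T (n + i) n * poly (A a (n + i)) x)
        = x * poly (A a n) x" if "a \<in> {1..p}" for a
    proof -
      have "(if n = 0 then 0 else A a (n - 1)) + (\<Sum>i\<in>{0..p}. Polynomial.smult (T (n + i) n) (A a (n + i)))
          = [:0, 1:] * A a n"
        using A that unfolding typeI_polys_def by blast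
      from arg_cong[OF this, of "\<lambda>q. poly q x"] show ?thesis
        by (simp add: poly_sum split: if_splits)
    qed
    then have "(\<Sum>a\<in>{1..p}. \<mu> a * ((if n = 0 then 0 else poly (A a (n - 1)) x)
        + (\<Sum>i\<in>{0..p}. T (n + i) n * poly (A a (n + i)) x))) = (\<Sum>a\<in>{1..p}. \<mu> a * (x * poly (A a n) x))"
      by (intro sum.cong) auto
    moreover have "(\<Sum>a\<in>{1..p}. \<mu> a * (\<Sum>i\<in>{0..p}. T (n + i) n * poly (A a (n + i)) x))
        = (\<Sum>i\<in>{0..p}. T (n + i) n * Q (n + i))"
      unfolding Q_def sum_distrib_left by (subst sum.swap) (simp add: mult_ac)
    moreover have "(\<Sum>a\<in>{1..p}. \<mu> a * (if n = 0 then 0 else poly (A a (n - 1)) x)) = (if n = 0 then 0 else Q (n - 1))"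
      by (simp add: Q_def)
    moreover have "(\<Sum>a\<in>{1..p}. \<mu> a * (x * poly (A a n) x)) = x * Q n"
      by (simp add: Q_def sum_distrib_left mult_ac)
    ultimately show ?thesis by (simp only: distrib_left sum.distrib)
  qed
  have "T (n + p) n \<noteq> 0" for n
    using T unfolding banded_hessenberg_def by (metis add_diff_cancel_right' le_add2)
  moreover have "(if n = 0 then 0 else w (n - 1)) + (\<Sum>i\<in>{0..p}. T (n + i) n * w (n + i)) = x * w n"
    if "n + p \<le> N" for n
    by (rule left_eigvec_recursion[OF T that]) (use left[of n] that in \<open>simp add: w_def x_def\<close>)
  ultimately have "Q l = w l"
    using banded_left_recursion_unique[of p T Q w N x l] p init rec l by blast
  then show ?thesis by (simp add: Q_def w_def x_def \<mu>_def)
qed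

lemma bracket_eq:
  assumes "\<And>r. r \<le> N \<Longrightarrow> (\<Sum>a\<in>{1..p}. mass p T \<nu> N (Suc r) a * poly (f a) (zero_B p T N (Suc r))) = w r"
  shows "bracket p T \<nu> N f g = (\<Sum>r<N + 1. w r * poly g (zero_B p T N (Suc r)))"
proof -
  have "bracket p T \<nu> N f g = (\<Sum>k\<in>{1..N + 1}.
      (\<Sum>a\<in>{1..p}. mass p T \<nu> N k a * poly (f a) (zero_B p T N k)) * poly g (zero_B p T N k))"
    unfolding bracket_def sum_distrib_right by (rule sum.swap)
  also have "\<dots> = (\<Sum>r<N + 1.
      (\<Sum>a\<in>{1..p}. mass p T \<nu> N (Suc r) a * poly (f a) (zero_B p T N (Suc r))) * poly g (zero_B p T N (Suc r)))"
    by (rule sum.reindex_bij_witness[of _ Suc "\<lambda>k. k - 1"]) auto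
  finally show ?thesis using assms by simp
qed

section \<open>Spectral representation of the iterated transition probabilities\<close>

theorem proposition20:
  fixes p N n k l :: nat
    and T :: "nat \<Rightarrow> nat \<Rightarrow> real"
    and \<nu> :: "real mat"
    and A :: "nat \<Rightarrow> nat \<Rightarrow> real poly"
  assumes "p \<ge> 1"
    and "banded_hessenberg p T"
    and "positive_bidiagonal_factorization p T"
    and "stochastic_associated T"
    and "lower_unitriangular p \<nu>"
    and "typeI_polys p T \<nu> A"
    and "N \<ge> p - 1"
    and "k \<in> {0..N}" and "l \<in> {0..N}"
  shows "(P_II p T N ^\<^sub>m n) $$ (k, l) =
           Theta_II p T N k l * bracket p T \<nu> N (\<lambda>a. A a l) (x_N p T N ^ n * B_poly p T k) \<and>
         (P_I p T N ^\<^sub>m n) $$ (k, l) =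
           Theta_I p T N l k * bracket p T \<nu> N (\<lambda>a. A a k) (x_N p T N ^ n * B_poly p T l)"
proof -
  note p = assms(1) and T = assms(2) and fac = assms(3)
  have k: "k \<le> N" and l: "l \<le> N" using assms by auto
  define E W where "E = eigvec_mat p T N" and "W = mat_inv E"
  define x where "x r = zero_B p T N (Suc r)" for r
  define S where "S = (1 / x 0) \<cdot>\<^sub>m trunc_mat T N"
  note Z = B_poly_zeros[OF p T fac, where N = N]
  note enum = zero_B_enum[OF Z(1,2)]
  have zero: "poly (B_poly p T (N + 1)) (x r) = 0" if "r \<le> N" for r
    using enum(1) that by (auto simp: bij_betw_def x_def)
  have u: "poly (B_poly p T i) (x 0) > 0" if "i \<le> N" for i
    using Z(3)[of "x 0" i] enum(2) that by (simp add: x_def)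
  have E: "E \<in> carrier_mat (N + 1) (N + 1)" unfolding E_def by (rule eigvec_mat_carrier)
  note W = mat_inv_det[OF E eigvec_mat_det[OF Z(1,2), folded E_def], folded W_def]
  have Tc: "trunc_mat T N \<in> carrier_mat (N + 1) (N + 1)" by (rule trunc_mat_carrier)
  have TE: "trunc_mat T N * E = E * mat_diag (N + 1) x"
    using trunc_mat_eigvec_mat[OF T] zero unfolding E_def x_def by blast

  have Sc: "S \<in> carrier_mat (N + 1) (N + 1)" using Tc by (simp add: S_def)
  have "S * E = (1 / x 0) \<cdot>\<^sub>m (trunc_mat T N * E)"
    unfolding S_def using Tc E by (rule mult_smult_assoc_mat)
  also have "\<dots> = E * mat_diag (N + 1) (\<lambda>r. x r / x 0)"
    unfolding TE mat_diag_mult_right[OF E] by (intro eq_matI) auto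
  finally have S_pow: "(S ^\<^sub>m n) $$ (i, j) = (\<Sum>r<N + 1. E $$ (i, r) * (x r / x 0) ^ n * W $$ (r, j))"
    if "i \<le> N" "j \<le> N" for i j
    using spectral_pow_entry[OF Sc E W(3,1,2), of "\<lambda>r. x r / x 0" i j n] that by simp

  have WT: "W * trunc_mat T N = mat_diag (N + 1) x * W"
  proof -
    have "W * trunc_mat T N = W * (trunc_mat T N * E) * W"
      using W E Tc by (simp add: assoc_mult_mat[of _ "N + 1" "N + 1" _ "N + 1" _ "N + 1"])
    also have "\<dots> = (W * E) * mat_diag (N + 1) x * W"
      unfolding TE using W(3) E by (simp add: assoc_mult_mat[of _ "N + 1" "N + 1" _ "N + 1" _ "N + 1"])
    finally show ?thesis unfolding W(2) left_mult_one_mat[OF mat_diag_dim] .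
  qed
  have left: "(\<Sum>i<Suc N. W $$ (r, i) * T i j) = x r * W $$ (r, j)" if "r \<le> N" "j \<le> N" for r j
  proof -
    have "(\<Sum>i<Suc N. W $$ (r, i) * T i j) = (W * trunc_mat T N) $$ (r, j)"
      using that W(3) by (simp add: trunc_mat_def scalar_prod_def lessThan_atLeast0)
    also have "\<dots> = x r * W $$ (r, j)"
      unfolding WT mat_diag_mult_left[OF W(3)] using that by simp
    finally show ?thesis .
  qed
  have bracket: "bracket p T \<nu> N (\<lambda>a. A a j) (x_N p T N ^ n * B_poly p T i) = (S ^\<^sub>m n) $$ (i, j)"
    if i: "i \<le> N" and j: "j \<le> N" for i j
  proof -
    have "bracket p T \<nu> N (\<lambda>a. A a j) (x_N p T N ^ n * B_poly p T i) =
        (\<Sum>r<N + 1. W $$ (r, j) * poly (x_N p T N ^ n * B_poly p T i) (zero_B p T N (Suc r)))"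
      using mass_typeI[OF p T assms(5,6,7) _ j] left
      by (intro bracket_eq) (auto simp: E_def W_def x_def)
    also have "\<dots> = (\<Sum>r<N + 1. E $$ (i, r) * (x r / x 0) ^ n * W $$ (r, j))"
      using i by (intro sum.cong) (simp_all add: x_N_def x_def E_def eigvec_mat_def poly_power)
    finally show ?thesis using S_pow[OF i j] by simp
  qed

  \<comment> \<open>Both stochastic matrices are diagonal conjugates of \<open>S\<close> or its transpose, by weights that do not vanish.\<close>
  have "pi_II p T N i \<noteq> 0" if "i < N + 1" for i
    using u[of i] that by (simp add: pi_II_def x_def)
  then have II: "(P_II p T N ^\<^sub>m n) $$ (k, l) = Theta_II p T N k l * (S ^\<^sub>m n) $$ (k, l)"
    using diag_conj_pow[OF Sc, of "pi_II p T N" k l n] k l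
    by (simp add: P_II_def Theta_II_def mat_inv_diag S_def x_def)

  have trunc: "poly (B_trunc T N m) (x 0) \<noteq> 0" if "1 \<le> m" "m \<le> N + 1" for m
    using B_trunc_nonzero[OF Hessenberg_nonneg[OF p fac] u B_poly_eigenvector[OF T zero]] that by blast
  have pi: "pi_I p T N i \<noteq> 0" if "i < N + 1" for i
    using trunc[of "i + 1"] trunc[of 1] that by (simp add: pi_I_def x_def)
  have "(P_I p T N ^\<^sub>m n) $$ (k, l) = Theta_I p T N l k * (transpose_mat S ^\<^sub>m n) $$ (k, l)"
  proof -
    have St: "transpose_mat S \<in> carrier_mat (N + 1) (N + 1)" using Sc by simp
    have "mat_diag (N + 1) (\<lambda>i. 1 / (1 / pi_I p T N i)) = mat_diag (N + 1) (pi_I p T N)" by simp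
    moreover have "transpose_mat S = (1 / x 0) \<cdot>\<^sub>m transpose_mat (trunc_mat T N)"
      using Tc by (intro eq_matI) (auto simp: S_def)
    ultimately show ?thesis
      using diag_conj_pow[OF St, of "\<lambda>i. 1 / pi_I p T N i" k l n] pi k l
      by (simp add: P_I_def Theta_I_def mat_inv_diag x_def mult.commute)
  qed
  also have "(transpose_mat S ^\<^sub>m n) $$ (k, l) = (S ^\<^sub>m n) $$ (l, k)"
    using transpose_pow[OF Sc, of n] carrier_matD[OF pow_carrier_mat[OF Sc, of n]] k l by simp
  finally have I: "(P_I p T N ^\<^sub>m n) $$ (k, l) = Theta_I p T N l k * (S ^\<^sub>m n) $$ (l, k)" .
  show ?thesis using I II bracket[OF k l] bracket[OF l k] by simp
qed

end
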